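(* Let $n,k$ be integers with $n/2<k<n$ and suppose spies always lie. Let $K(n,k)=2(n-k)-B(n-k)$ and write $n=q(n-k+1)+r$ with $0\le r\le n-k$. Put $\overline{T}_L(n,k)=n-q+1$ if $r=0$ and $n-q$ if $r\ge1$; put $\widetilde{T}_L(n,k)=n-q$ if $r\in\{0,1\}$ and $n-q-1$ if $r\ge 2$, except $\widetilde{T}_L(5,3)=4$. Then there is an adaptive questioning strategy which, for every consistent assignment of identities, identifies a knight by question $K(n,k)$, determines the identity of Person $1$ by question $K(n,k)+1$, and by question $\overline{T}_L(n,k)$ either identifies a spy or proves that everyone in the room is a knight. Moreover, if a spy is known to be present, then (this strategy) identifies a spy by question $\widetilde{T}_L(n,k)$.
   Context: There are $n$ people, numbered $1,\dots,n$, each either a knight or a spy; at least $k$ are knights. The only permitted questions have the form "Person $x$, is Person $y$ a spy?" with $x\ne y$, answered "yes" or "no" by Person $x$; questions may be chosen adaptively. Knights always answer truthfully and spies always lie. "Identifies by question $t$" means that after at most $t$ questions the fact in question is determined with certainty from the answers. $B(s)$ denotes the number of $1$s in the binary expansion of $s\in\mathbf{N}$. *)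

theory Defs
  imports Main
begin

definition people :: "nat \<Rightarrow> nat set" where
  "people n = {1..n}"

text \<open>An assignment of identities to the people is represented by its set of spies.\<close>

definition assignments :: "nat \<Rightarrow> nat \<Rightarrow> nat set set" where
  "assignments n k = {S. S \<subseteq> people n \<and> k \<le> card (people n - S)}"

text \<open>The question \<open>(x, y)\<close> is "Person \<open>x\<close>, is Person \<open>y\<close> a spy?"; the answer
  \<^const>\<open>True\<close> means "yes".\<close>

type_synonym question = "nat \<times> nat"

definition permitted :: "nat \<Rightarrow> question \<Rightarrow> bool" where
  "permitted n q \<longleftrightarrow> fst q \<in> people n \<and> snd q \<in> people n \<and> fst q \<noteq> snd q"

definition answer :: "nat set \<Rightarrow> question \<Rightarrow> bool" where
  "answer S q = (if fst q \<in> S then snd q \<notin> S else snd q \<in> S)"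

text \<open>An adaptive strategy maps the list of answers received so far, oldest first, to the
  next question. The earlier questions need not be recorded, since they are determined by the
  strategy and the earlier answers. Strategies never stop, which is harmless: superfluous
  questions lose no information.\<close>

type_synonym strategy = "bool list \<Rightarrow> question"

definition valid_strategy :: "nat \<Rightarrow> strategy \<Rightarrow> bool" where
  "valid_strategy n \<sigma> \<longleftrightarrow> (\<forall>h. permitted n (\<sigma> h))"

primrec transcript :: "strategy \<Rightarrow> nat set \<Rightarrow> nat \<Rightarrow> bool list" where
  "transcript \<sigma> S 0 = []"
| "transcript \<sigma> S (Suc t) = transcript \<sigma> S t @ [answer S (\<sigma> (transcript \<sigma> S t))]"

text \<open>In the following, \<open>W\<close> is the set of assignments that are possible a priori.
  \<open>possible \<sigma> W S t\<close> is the set of those still possible after \<open>t\<close> questions when the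
  actual assignment is \<open>S\<close>; a fact is determined iff it holds throughout this set.\<close>

definition possible :: "strategy \<Rightarrow> nat set set \<Rightarrow> nat set \<Rightarrow> nat \<Rightarrow> nat set set" where
  "possible \<sigma> W S t = {S' \<in> W. transcript \<sigma> S' t = transcript \<sigma> S t}"

definition knight_identified ::
    "nat \<Rightarrow> strategy \<Rightarrow> nat set set \<Rightarrow> nat set \<Rightarrow> nat \<Rightarrow> bool" where
  "knight_identified n \<sigma> W S t \<longleftrightarrow>
     (\<exists>p\<in>people n. \<forall>S'\<in>possible \<sigma> W S t. p \<notin> S')"

definition spy_identified ::
    "nat \<Rightarrow> strategy \<Rightarrow> nat set set \<Rightarrow> nat set \<Rightarrow> nat \<Rightarrow> bool" where
  "spy_identified n \<sigma> W S t \<longleftrightarrow>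
     (\<exists>p\<in>people n. \<forall>S'\<in>possible \<sigma> W S t. p \<in> S')"

definition identity_determined ::
    "nat \<Rightarrow> strategy \<Rightarrow> nat set set \<Rightarrow> nat set \<Rightarrow> nat \<Rightarrow> bool" where
  "identity_determined p \<sigma> W S t \<longleftrightarrow>
     (\<forall>S'\<in>possible \<sigma> W S t. p \<in> S') \<or> (\<forall>S'\<in>possible \<sigma> W S t. p \<notin> S')"

definition all_knights_proved ::
    "strategy \<Rightarrow> nat set set \<Rightarrow> nat set \<Rightarrow> nat \<Rightarrow> bool" where
  "all_knights_proved \<sigma> W S t \<longleftrightarrow> (\<forall>S'\<in>possible \<sigma> W S t. S' = {})"

definition binary_ones :: "nat \<Rightarrow> nat" where
  "binary_ones s = card {i. bit s i}"

text \<open>For \<open>k < n\<close> none of the natural-number subtractions below is truncated: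
  \<^prop>\<open>binary_ones s \<le> s\<close> and \<^prop>\<open>n div (n - k + 1) \<le> n div 2\<close>.\<close>

definition K :: "nat \<Rightarrow> nat \<Rightarrow> nat" where
  "K n k = 2 * (n - k) - binary_ones (n - k)"

definition T_bar :: "nat \<Rightarrow> nat \<Rightarrow> nat" where
  "T_bar n k =
     (let q = n div (n - k + 1); r = n mod (n - k + 1)
      in if r = 0 then n - q + 1 else n - q)"

definition T_tilde :: "nat \<Rightarrow> nat \<Rightarrow> nat" where
  "T_tilde n k =
     (if n = 5 \<and> k = 3 then 4
      else let q = n div (n - k + 1); r = n mod (n - k + 1)
           in if r \<in> {0, 1} then n - q else n - q - 1)"

end

theory Submission
  imports Defs
begin

text \<open>Knights tell the truth and spies lie, so the answer to a question reveals exactly whether the two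
  people involved are of the same type. Let \<open>s = n - k\<close>.

  Blocks of people known to be of the same type are joined until a block of size \<open>s + 1\<close>, necessarily
  of knights, appears after \<open>s\<close> questions; it is put together from blocks whose sizes are the binary
  digits of \<open>s\<close>, smallest first, together with one further person. Its member Person 1 then tests
  the others, who are first gathered in groups of size \<open>s + 1\<close> as long as possible: such a group
  consists of knights if its members agree, and a disagreement leads to a spy with one further
  question.

  If blocks \<open>X\<close> and \<open>Y\<close> with \<open>|Y| \<le> |X|\<close> are found to be different earlier, then \<open>|X| - |Y|\<close> members
  of \<open>X\<close> remain, and at most \<open>s - |Y|\<close> of those still relevant are spies. All blocks are split into
  blocks whose sizes are powers of two, and blocks of equal size are compared: equal ones are joined,
  different ones discarded. Subadditivity of the binary digit sum shows that the number of
  questions does not exceed \<open>K n k\<close> until all sizes are distinct, when the largest block must consist of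
  knights. Person 1 is kept in the largest block, or linked to an accusation, so that
  one further question settles both a spy and Person 1.\<close>

subsection \<open>Binary digit sums\<close>

lemma bits_even: "{i. bit (2 * m) i} = Suc ` {i. bit (m::nat) i}"
proof (intro set_eqI iffI)
  fix i assume "i \<in> {i. bit (2 * m) i}"
  then show "i \<in> Suc ` {i. bit m i}"
    by (cases i) (auto simp: bit_0 bit_Suc)
qed (auto simp: bit_Suc)

lemma bits_odd: "{i. bit (2 * m + 1) i} = insert 0 (Suc ` {i. bit (m::nat) i})"
proof (intro set_eqI iffI)
  fix i assume "i \<in> {i. bit (2 * m + 1) i}"
  then show "i \<in> insert 0 (Suc ` {i. bit m i})"
    by (cases i) (auto simp: bit_0 bit_Suc)
qed (auto simp: bit_Suc bit_0)

lemma finite_bits: "finite {i. bit (m::nat) i}"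
proof (induction m rule: less_induct)
  case (less m)
  show ?case
  proof (cases "m = 0")
    case False
    then have "finite {i. bit (m div 2) i}" using less by simp
    moreover have "m = 2 * (m div 2) \<or> m = 2 * (m div 2) + 1" by presburger
    ultimately show ?thesis
      by (metis bits_even bits_odd finite_imageI finite.insertI)
  qed simp
qed

lemma binary_ones_0 [simp]: "binary_ones 0 = 0"
  by (simp add: binary_ones_def)

lemma binary_ones_double [simp]: "binary_ones (2 * m) = binary_ones m"
  by (simp add: binary_ones_def bits_even card_image)

lemma binary_ones_double_add_1 [simp]: "binary_ones (2 * m + 1) = binary_ones m + 1"
  unfolding binary_ones_def bits_odd by (subst card_insert_disjoint) (auto simp: finite_bits card_image)

lemma binary_ones_Suc_double [simp]: "binary_ones (Suc (2 * m)) = Suc (binary_ones m)"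
  using binary_ones_double_add_1[of m] by simp

lemma binary_ones_1 [simp]: "binary_ones 1 = 1"
  using binary_ones_double_add_1[of 0] by simp

lemma binary_ones_Suc_0 [simp]: "binary_ones (Suc 0) = 1"
  using binary_ones_1 by simp

lemma binary_ones_power2_mult [simp]: "binary_ones (2 ^ j * m) = binary_ones m"
  by (induction j) (simp_all add: mult.assoc)

lemma binary_ones_power2 [simp]: "binary_ones (2 ^ j) = 1"
  using binary_ones_power2_mult[of j 1] by simp

text \<open>In binary addition every carry replaces two ones by a single one. The induction halves
  both summands.\<close>

lemma binary_ones_add_le: "binary_ones (a + b) \<le> binary_ones a + binary_ones b"
proof (induction "a + b" arbitrary: a b rule: less_induct)
  case less
  show ?case
  proof (cases "a = 0 \<or> b = 0")
    case False
    define a' b' where "a' = a div 2" and "b' = b div 2"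
    have IH: "binary_ones (a' + b') \<le> binary_ones a' + binary_ones b'"
      by (rule less) (use False in \<open>auto simp: a'_def b'_def\<close>)
    \<comment> \<open>Two odd summands send a carry into the sum of the halves. It is treated as a
      further summand 1: apart from the case \<open>a + b = 2\<close>, the induction hypothesis is
      applied to \<open>a' + b'\<close> and \<open>1\<close>.\<close>
    have carry: "binary_ones (a' + b' + 1) \<le> binary_ones (a' + b') + 1" if "odd a" "odd b"
    proof (cases "a + b = 2")
      case False
      then show ?thesis using less[of "a' + b'" 1] that
        by (auto simp: a'_def b'_def elim!: oddE)
    next
      case True
      then have "a = 1" "b = 1" using \<open>\<not> (a = 0 \<or> b = 0)\<close> by auto
      then show ?thesis by (simp add: a'_def b'_def)
    qed
    have "a = 2 * a' \<or> a = 2 * a' + 1" "b = 2 * b' \<or> b = 2 * b' + 1"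
      unfolding a'_def b'_def by presburger+
    then consider "a = 2 * a'" "b = 2 * b'" | "a = 2 * a' + 1" "b = 2 * b'"
      | "a = 2 * a'" "b = 2 * b' + 1" | "a = 2 * a' + 1" "b = 2 * b' + 1"
      by blast
    then show ?thesis
    proof cases
      case 1
      then have "a + b = 2 * (a' + b')" by simp
      then have "binary_ones (a + b) = binary_ones (a' + b')" by (metis binary_ones_double)
      with 1 IH show ?thesis by (metis binary_ones_double)
    next
      case 2
      then have "a + b = 2 * (a' + b') + 1" by simp
      then have "binary_ones (a + b) = binary_ones (a' + b') + 1"
        by (metis binary_ones_double_add_1)
      moreover have "binary_ones a = binary_ones a' + 1" "binary_ones b = binary_ones b'"
        using 2 by (metis binary_ones_double_add_1, metis binary_ones_double)
      ultimately show ?thesis using IH by linarith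
    next
      case 3
      then have "a + b = 2 * (a' + b') + 1" by simp
      then have "binary_ones (a + b) = binary_ones (a' + b') + 1"
        by (metis binary_ones_double_add_1)
      moreover have "binary_ones b = binary_ones b' + 1" "binary_ones a = binary_ones a'"
        using 3 by (metis binary_ones_double_add_1, metis binary_ones_double)
      ultimately show ?thesis using IH by linarith
    next
      case 4
      then have "a + b = 2 * (a' + b' + 1)" by simp
      then have "binary_ones (a + b) = binary_ones (a' + b' + 1)"
        by (metis binary_ones_double)
      moreover have "binary_ones b = binary_ones b' + 1" "binary_ones a = binary_ones a' + 1"
        using 4 by (metis binary_ones_double_add_1)+
      moreover have "odd a" "odd b" using 4 by (metis even_mult_iff even_plus_one_iff dvd_refl)+
      ultimately show ?thesis using IH carry by linarith
    qed
  qed auto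
qed

lemma binary_ones_le: "binary_ones m \<le> m"
proof (induction m)
  case (Suc m)
  then show ?case using binary_ones_add_le[of m 1] by simp
qed simp

lemma binary_ones_pos: "m > 0 \<Longrightarrow> binary_ones m > 0"
proof (induction m rule: less_induct)
  case (less m)
  have "m = 2 * (m div 2) \<or> m = 2 * (m div 2) + 1" by presburger
  then show ?case
  proof
    assume m: "m = 2 * (m div 2)"
    then have "binary_ones (m div 2) > 0" using less by simp
    then show ?thesis using m by (metis binary_ones_double)
  next
    assume "m = 2 * (m div 2) + 1"
    then show ?thesis by (metis binary_ones_double_add_1 less_add_one not_gr_zero not_less0)
  qed
qed

lemma binary_ones_eq_1: "binary_ones m = 1 \<Longrightarrow> \<exists>j. m = 2 ^ j"
proof (induction m rule: less_induct)
  case (less m)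
  have m0: "m \<noteq> 0" using less.prems by (metis binary_ones_0 zero_neq_one)
  have "m = 2 * (m div 2) \<or> m = 2 * (m div 2) + 1" by presburger
  then show ?case
  proof
    assume m: "m = 2 * (m div 2)"
    then have "binary_ones (m div 2) = 1" using less by (metis binary_ones_double)
    then obtain j where "m div 2 = 2 ^ j" using less.IH[of "m div 2"] m0 by auto
    then have "m = 2 ^ Suc j" using m by simp
    then show ?thesis by blast
  next
    assume m: "m = 2 * (m div 2) + 1"
    then have "binary_ones (m div 2) = 0" using less.prems by (metis binary_ones_double_add_1 add_right_cancel add_0)
    then have "m div 2 = 0" using binary_ones_pos by fastforce
    then have "m = 2 ^ 0" using m by simp
    then show ?thesis by blast
  qed
qed

text \<open>The digits of \<open>r\<close> all lie below those of \<open>2 ^ b * h\<close>, so the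
  addition has no carries.\<close>

lemma binary_ones_split:
  "r < 2 ^ b \<Longrightarrow> binary_ones (2 ^ b * h + r) = binary_ones h + binary_ones r"
proof (induction b arbitrary: r)
  case (Suc b)
  define r' where "r' = r div 2"
  have IH: "binary_ones (2 ^ b * h + r') = binary_ones h + binary_ones r'"
    using Suc by (simp add: r'_def)
  have "r = 2 * r' \<or> r = 2 * r' + 1" unfolding r'_def by presburger
  then show ?case
  proof
    assume r: "r = 2 * r'"
    then have "2 ^ Suc b * h + r = 2 * (2 ^ b * h + r')" by simp
    then show ?thesis using IH r by (metis binary_ones_double)
  next
    assume r: "r = 2 * r' + 1"
    then have "2 ^ Suc b * h + r = 2 * (2 ^ b * h + r') + 1" by simp
    then show ?thesis using IH r by (metis binary_ones_double_add_1 add.assoc)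
  qed
qed simp

text \<open>Subtraction from \<open>2 ^ b - 1\<close> flips each of the \<open>b\<close> low
  digits.\<close>

lemma binary_ones_complement:
  "r < 2 ^ b \<Longrightarrow> binary_ones (2 ^ b - 1 - r) + binary_ones r = b"
proof (induction b arbitrary: r)
  case (Suc b)
  define r' where "r' = r div 2"
  have IH: "binary_ones (2 ^ b - 1 - r') + binary_ones r' = b"
    using Suc by (simp add: r'_def)
  have lt: "r' < 2 ^ b" using Suc.prems by (simp add: r'_def less_mult_imp_div_less mult.commute)
  have "r = 2 * r' \<or> r = 2 * r' + 1" unfolding r'_def by presburger
  then show ?case
  proof
    assume r: "r = 2 * r'"
    then have "2 ^ Suc b - 1 - r = 2 * (2 ^ b - 1 - r') + 1" using lt by simp
    then have "binary_ones (2 ^ Suc b - 1 - r) = binary_ones (2 ^ b - 1 - r') + 1"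
      by (metis binary_ones_double_add_1)
    then show ?thesis using IH r by simp
  next
    assume r: "r = 2 * r' + 1"
    then have "2 ^ Suc b - 1 - r = 2 * (2 ^ b - 1 - r')" using lt by simp
    then have "binary_ones (2 ^ Suc b - 1 - r) = binary_ones (2 ^ b - 1 - r')"
      by (metis binary_ones_double)
    then show ?thesis using IH r by (metis binary_ones_double_add_1 add.assoc add_Suc_right Suc_eq_plus1)
  qed
qed simp

text \<open>The budget condition met when the block made from bit \<open>b\<close> of \<open>s\<close> is compared with the
  block of size \<open>s mod 2 ^ b + 1\<close> made from the lower bits; it holds with equality.\<close>

lemma binary_ones_budget:
  fixes s b :: nat
  defines "r \<equiv> s mod 2 ^ b"
  assumes "odd (s div 2 ^ b)"
  shows "binary_ones (2 ^ b - (r + 1)) + binary_ones s = 1 + binary_ones (s - (r + 1))"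
proof -
  obtain h where h: "s div 2 ^ b = 2 * h + 1" using assms by (blast elim: oddE)
  have r: "r < 2 ^ b" by (simp add: r_def)
  have s: "s = 2 ^ b * (2 * h + 1) + r"
    unfolding r_def h[symmetric] by simp
  have lt: "2 ^ b - 1 < (2::nat) ^ b" by simp
  \<comment> \<open>Subtracting \<open>r\<close> clears the low digits, and the remaining unit is
    borrowed from bit \<open>b\<close>: that bit becomes 0 and all lower bits become 1.\<close>
  have "s - (r + 1) = 2 ^ b * (2 * h) + (2 ^ b - 1)" by (subst s) (simp add: algebra_simps)
  then have 1: "binary_ones (s - (r + 1)) = binary_ones (2 * h) + binary_ones (2 ^ b - 1)"
    by (simp only: binary_ones_split[OF lt])
  have 2: "binary_ones s = binary_ones (2 * h + 1) + binary_ones r"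
    by (subst s) (rule binary_ones_split[OF r])
  have 3: "binary_ones (2 ^ b - (r + 1)) + binary_ones r = b"
    using binary_ones_complement[OF r] by simp
  have 4: "binary_ones (2 ^ b - 1) = b" using binary_ones_complement[of 0 b] by simp
  show ?thesis using 1 2 3 4 by simp
qed

text \<open>Subadditivity for \<open>2 ^ i + (s - 2 ^ i)\<close>. It yields the budget for comparing
  two blocks of equal size \<open>2 ^ i\<close>, where no surplus has to be split.\<close>

lemma binary_ones_budget_power2:
  fixes s i :: nat
  assumes "2 ^ i \<le> s"
  shows "binary_ones s \<le> 1 + binary_ones (s - 2 ^ i)"
  using binary_ones_add_le[of "2 ^ i" "s - 2 ^ i"] assms by simp

subsection \<open>Disjoint families of blocks\<close>

definition power2_family :: "nat set set \<Rightarrow> bool" where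
  "power2_family F \<longleftrightarrow> finite F \<and> pairwise disjnt F \<and> (\<forall>A\<in>F. finite A \<and> (\<exists>j. card A = 2 ^ j))"

lemma power2_family_nonempty: "power2_family F \<Longrightarrow> A \<in> F \<Longrightarrow> A \<noteq> {}"
  unfolding power2_family_def by (metis card.empty power_not_zero zero_neq_numeral)

lemma power2_family_finite_Union: "power2_family F \<Longrightarrow> finite (\<Union>F)"
  unfolding power2_family_def by blast

lemma card_power2_family: "power2_family F \<Longrightarrow> card (\<Union>F) = (\<Sum>A\<in>F. card A)"
  unfolding power2_family_def by (intro card_Union_disjoint) auto

lemma binary_ones_sum_le: "finite F \<Longrightarrow> binary_ones (\<Sum>A\<in>F. f A) \<le> (\<Sum>A\<in>F. binary_ones (f A))"
proof (induction F rule: finite_induct)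
  case (insert x F)
  then show ?case using binary_ones_add_le[of "f x" "\<Sum>A\<in>F. f A"] by simp
qed simp

text \<open>Each block contributes one binary digit, and digit sums are subadditive. In the hunt
  this turns a joint budget for time and number of blocks into a bound on the time alone.\<close>

lemma binary_ones_power2_family_le:
  assumes "power2_family F"
  shows "binary_ones (card (\<Union>F)) \<le> card F"
proof -
  have "binary_ones (card (\<Union>F)) \<le> (\<Sum>A\<in>F. binary_ones (card A))"
    using assms binary_ones_sum_le[of F card] card_power2_family by (simp add: power2_family_def)
  also have "\<dots> = (\<Sum>A\<in>F. 1)"
    using assms by (intro sum.cong) (auto simp: power2_family_def)
  finally show ?thesis by simp
qed

text \<open>Distinct powers of two up to \<open>card M\<close> add up to at most
  \<open>2 * card M - 1\<close>. Hence the largest block holds a strict majority.\<close>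

lemma card_distinct_power2_family_less:
  assumes F: "power2_family F" and inj: "inj_on card F" and M: "M \<in> F" "\<And>A. A \<in> F \<Longrightarrow> card A \<le> card M"
  shows "card (\<Union>F) < 2 * card M"
proof -
  obtain m where m: "card M = 2 ^ m" using F M by (auto simp: power2_family_def)
  define J where "J = {j. 2 ^ j \<in> card ` F}"
  have img: "card ` F = (\<lambda>j. 2 ^ j) ` J"
    using F unfolding J_def power2_family_def by force
  have J: "J \<subseteq> {..<Suc m}"
  proof
    fix j assume "j \<in> J"
    then have "(2::nat) ^ j \<le> 2 ^ m" using M m unfolding J_def by force
    then show "j \<in> {..<Suc m}" by (simp add: less_Suc_eq_le)
  qed
  have "card (\<Union>F) = (\<Sum>A\<in>F. card A)" by (rule card_power2_family[OF F])
  also have "\<dots> = \<Sum> (card ` F)" using inj by (simp add: sum.reindex)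
  also have "\<dots> = (\<Sum>j\<in>J. 2 ^ j)" unfolding img by (subst sum.reindex) (auto simp: inj_on_def)
  also have "\<dots> \<le> (\<Sum>j<Suc m. 2 ^ j)" using J by (intro sum_mono2) auto
  also have "\<dots> = 2 ^ Suc m - 1" by (simp only: lessThan_atLeast0 sum_power2)
  also have "\<dots> < 2 * card M" by (simp add: m)
  finally show ?thesis .
qed

lemma power2_family_insert:
  assumes "power2_family F" "finite A" "card A = 2 ^ j" "A \<inter> \<Union>F = {}"
  shows "power2_family (insert A F)" "A \<notin> F" "card (insert A F) = card F + 1"
    "card (\<Union>(insert A F)) = card A + card (\<Union>F)"
proof -
  have "A \<noteq> {}" using assms by (metis card.empty power_not_zero zero_neq_numeral)
  then show "A \<notin> F" using assms by auto
  then show "card (insert A F) = card F + 1" using assms by (auto simp: power2_family_def)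
  show "power2_family (insert A F)"
    using assms unfolding power2_family_def pairwise_insert disjnt_def by auto
  show "card (\<Union>(insert A F)) = card A + card (\<Union>F)"
    using assms power2_family_finite_Union by (simp add: card_Un_disjoint)
qed

lemma power2_family_subset: "power2_family F \<Longrightarrow> G \<subseteq> F \<Longrightarrow> power2_family G"
  unfolding power2_family_def by (auto intro: finite_subset pairwise_subset)

lemma power2_family_Un:
  assumes "power2_family F" "power2_family G" "\<Union>F \<inter> \<Union>G = {}"
  shows "power2_family (F \<union> G)" "card (F \<union> G) = card F + card G"
    "card (\<Union>(F \<union> G)) = card (\<Union>F) + card (\<Union>G)"
proof -
  show "power2_family (F \<union> G)"
    using assms unfolding power2_family_def pairwise_def disjnt_def
    by (auto 0 3)
  have "F \<inter> G = {}"
    using assms power2_family_nonempty[OF assms(1)] by blast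
  then show "card (F \<union> G) = card F + card G"
    using assms by (auto simp: power2_family_def card_Un_disjoint)
  show "card (\<Union>(F \<union> G)) = card (\<Union>F) + card (\<Union>G)"
    using assms power2_family_finite_Union by (simp add: card_Un_disjoint)
qed

lemma power2_family_remove2:
  assumes F: "power2_family F" and A: "A \<in> F" and B: "B \<in> F" and ne: "A \<noteq> B"
  shows "power2_family (F - {A, B})" "card F = card (F - {A, B}) + 2"
    "card (\<Union>F) = card (\<Union>(F - {A, B})) + card A + card B"
    "A \<inter> B = {}" "(A \<union> B) \<inter> \<Union>(F - {A, B}) = {}"
proof -
  show G: "power2_family (F - {A, B})" by (rule power2_family_subset[OF F]) auto
  have fin: "finite F" "finite A" "finite B" using F A B by (auto simp: power2_family_def)
  have pd: "C \<inter> D = {}" if "C \<in> F" "D \<in> F" "C \<noteq> D" for C D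
    using F that by (auto simp: power2_family_def pairwise_def disjnt_def)
  show AB: "A \<inter> B = {}" using pd A B ne by blast
  show d: "(A \<union> B) \<inter> \<Union>(F - {A, B}) = {}" using pd A B by blast
  show "card F = card (F - {A, B}) + 2"
    using card_Diff_subset[of "{A, B}" F] card_mono[OF fin(1), of "{A, B}"] A B ne by simp
  have "\<Union>F = (A \<union> B) \<union> \<Union>(F - {A, B})" using A B by blast
  then have "card (\<Union>F) = card (A \<union> B) + card (\<Union>(F - {A, B}))"
    using d fin power2_family_finite_Union[OF G] by (simp add: card_Un_disjoint)
  then show "card (\<Union>F) = card (\<Union>(F - {A, B})) + card A + card B"
    using AB fin by (simp add: card_Un_disjoint)
qed

lemma power2_family_singletons:
  assumes "finite A"
  shows "power2_family ((\<lambda>x. {x}) ` A)" "card ((\<lambda>x. {x}) ` A) = card A"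
  using assms unfolding power2_family_def
  by (auto simp: pairwise_def disjnt_def card_image intro: exI[of _ 0])

text \<open>Serves to split a block under construction so that Person 1, if present, lies in the
  first part.\<close>

lemma obtain_subset_with_card_and_element:
  assumes "finite N" "1 \<le> m" "m \<le> card N"
  obtains M where "M \<subseteq> N" "card M = m" "x \<in> N \<Longrightarrow> x \<in> M"
proof (cases "x \<in> N")
  case True
  then have "m - 1 \<le> card (N - {x})" using assms by simp
  then obtain M where M: "M \<subseteq> N - {x}" "card M = m - 1" "finite M"
    using obtain_subset_with_card_n by metis
  then have "card (insert x M) = m" using assms(2) by (subst card_insert_disjoint) auto
  then show ?thesis using that[of "insert x M"] True M by blast
next
  case False
  then show ?thesis using obtain_subset_with_card_n[OF assms(3)] that by metis
qed

lemma split_power2_family: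
  assumes "finite A"
  shows "\<exists>F. power2_family F \<and> \<Union>F = A \<and> card F = binary_ones (card A)"
proof -
  \<comment> \<open>The factor \<open>2 ^ j\<close> lets the induction halve \<open>m\<close>: an
    odd \<open>m\<close> gives off a block of size \<open>2 ^ j\<close>, and the rest is treated
    with exponent \<open>Suc j\<close>.\<close>
  have "\<exists>F. power2_family F \<and> \<Union>F = A \<and> card F = binary_ones m" if "card A = 2 ^ j * m" for m j
    using assms that
  proof (induction m arbitrary: A j rule: less_induct)
    case (less m)
    have "m = 0 \<or> m > 0 \<and> m = 2 * (m div 2) \<or> m = 2 * (m div 2) + 1" by presburger
    then consider "m = 0" | "m > 0" "m = 2 * (m div 2)" | "m = 2 * (m div 2) + 1" by blast
    then show ?case
    proof cases
      case 1
      then show ?thesis using less.prems by (intro exI[of _ "{}"]) (auto simp: power2_family_def)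
    next
      case 2
      have "card A = 2 ^ Suc j * (m div 2)" using less.prems 2 by (metis power_Suc2 mult.assoc)
      then have "\<exists>F. power2_family F \<and> \<Union>F = A \<and> card F = binary_ones (m div 2)"
        using less.IH[of "m div 2" A "Suc j"] less.prems 2 by simp
      then show ?thesis using 2 by (metis binary_ones_double)
    next
      case 3
      have cA: "card A = 2 ^ j + 2 ^ Suc j * (m div 2)"
        using less.prems(2) by (subst (asm) 3) (simp add: algebra_simps)
      then obtain C where C: "C \<subseteq> A" "card C = 2 ^ j" "finite C"
        using obtain_subset_with_card_n[of "2 ^ j" A] by auto
      have "card (A - C) = 2 ^ Suc j * (m div 2)" using C cA by (simp add: card_Diff_subset)
      moreover have "m div 2 < m" using 3 by presburger
      ultimately obtain F where F: "power2_family F" "\<Union>F = A - C" "card F = binary_ones (m div 2)"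
        using less.IH[of "m div 2" "A - C" "Suc j"] less.prems by auto
      have "binary_ones m = card F + 1" using 3 F by (metis binary_ones_double_add_1)
      then show ?thesis
        using power2_family_insert[OF F(1) C(3,2)] F C by (intro exI[of _ "insert C F"]) auto
    qed
  qed
  from this[of 0 "card A"] show ?thesis by simp
qed

subsection \<open>The questioning game\<close>

definition knight_known :: "nat \<Rightarrow> nat set set \<Rightarrow> bool" where
  "knight_known n V \<longleftrightarrow> (\<exists>p\<in>people n. \<forall>S\<in>V. p \<notin> S)"

definition spy_known :: "nat \<Rightarrow> nat set set \<Rightarrow> bool" where
  "spy_known n V \<longleftrightarrow> (\<exists>p\<in>people n. \<forall>S\<in>V. p \<in> S)"

definition identity_known :: "nat \<Rightarrow> nat set set \<Rightarrow> bool" where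
  "identity_known p V \<longleftrightarrow> (\<forall>S\<in>V. p \<in> S) \<or> (\<forall>S\<in>V. p \<notin> S)"

text \<open>\<open>kd\<close>, \<open>td\<close> and \<open>bd\<close> are the deadlines for identifying a knight, for identifying a spy
  when one is known to be present, and for identifying a spy or proving that there is none;
  Person 1 is due one question after the knight.
  A position \<open>V\<close> is the set of assignments that are still possible.\<close>

locale knight_spy_game =
  fixes n kd td bd :: nat
  assumes two_people: "2 \<le> n"
begin

text \<open>Removing \<open>{}\<close> from \<open>V\<close> expresses the knowledge that a spy is
  present, so one and the same strategy is judged with and without this knowledge.\<close>

definition on_time :: "nat \<Rightarrow> nat set set \<Rightarrow> bool" where
  "on_time t V \<longleftrightarrow>
     (kd \<le> t \<longrightarrow> knight_known n V) \<and>
     (kd + 1 \<le> t \<longrightarrow> identity_known 1 V) \<and>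
     (bd \<le> t \<longrightarrow> spy_known n V \<or> V \<subseteq> {{}}) \<and>
     (td \<le> t \<longrightarrow> spy_known n (V - {{}}))"

text \<open>A finite tree of questions. \<open>finish\<close> requires facts that no later answer
  can destroy, so the deadlines need checking only at the inner nodes.\<close>

inductive win :: "nat \<Rightarrow> nat set set \<Rightarrow> bool" where
  finish: "knight_known n V \<Longrightarrow> identity_known 1 V \<Longrightarrow> spy_known n V \<or> V \<subseteq> {{}} \<Longrightarrow> win t V"
| ask: "on_time t V \<Longrightarrow> permitted n (x, y) \<Longrightarrow>
    win (Suc t) {S \<in> V. answer S (x, y)} \<Longrightarrow> win (Suc t) {S \<in> V. \<not> answer S (x, y)} \<Longrightarrow> win t V"

lemma one_in_people [simp]: "Suc 0 \<in> people n"
  using two_people by (simp add: people_def)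

lemma spy_known_subset: "spy_known n V \<Longrightarrow> V' \<subseteq> V \<Longrightarrow> spy_known n V'"
  by (auto simp: spy_known_def)

lemma knight_known_subset: "knight_known n V \<Longrightarrow> V' \<subseteq> V \<Longrightarrow> knight_known n V'"
  by (auto simp: knight_known_def)

lemma identity_known_subset: "identity_known p V \<Longrightarrow> V' \<subseteq> V \<Longrightarrow> identity_known p V'"
  by (auto simp: identity_known_def)

lemma spy_known_empty: "spy_known n {}"
  using one_in_people unfolding spy_known_def by blast

lemma on_time_antimono:
  assumes "on_time t V" "V' \<subseteq> V"
  shows "on_time t V'"
proof -
  have "V' - {{}} \<subseteq> V - {{}}" using assms(2) by blast
  then show ?thesis
    using assms knight_known_subset[of V V'] identity_known_subset[of 1 V V']
      spy_known_subset[of V V'] spy_known_subset[of "V - {{}}" "V' - {{}}"]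
    unfolding on_time_def by blast
qed

lemma win_antimono: "win t V \<Longrightarrow> V' \<subseteq> V \<Longrightarrow> win t V'"
proof (induction arbitrary: V' rule: win.induct)
  case (finish V t)
  then show ?case
    using knight_known_subset[of V V'] identity_known_subset[of 1 V V'] spy_known_subset[of V V']
    by (intro win.finish) auto
next
  case (ask t V x y)
  show ?case
  proof (rule win.ask[OF on_time_antimono[OF ask.hyps(1) ask.prems] ask.hyps(2)])
    show "win (Suc t) {S \<in> V'. answer S (x, y)}" by (rule ask.IH(1)) (use ask.prems in blast)
    show "win (Suc t) {S \<in> V'. \<not> answer S (x, y)}" by (rule ask.IH(2)) (use ask.prems in blast)
  qed
qed

lemma win_empty: "win t {}"
  using spy_known_empty one_in_people
  by (intro win.finish) (auto simp: knight_known_def identity_known_def simp del: one_in_people)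

lemma win_wait:
  assumes "on_time t V" "win (Suc t) V"
  shows "win t V"
  by (rule win.ask[where x = 1 and y = 2])
    (use assms two_people in \<open>auto simp: permitted_def people_def intro: win_antimono\<close>)

lemma win_ask:
  assumes "on_time t V" "x \<in> people n" "y \<in> people n"
    and "win (Suc t) {S \<in> V. x \<in> S \<longleftrightarrow> y \<in> S}" "win (Suc t) {S \<in> V. x \<in> S \<longleftrightarrow> y \<notin> S}"
  shows "win t V"
proof (cases "x = y")
  case True
  have "{S \<in> V. x \<in> S \<longleftrightarrow> y \<in> S} = V" unfolding True by blast
  then show ?thesis using win_wait[OF assms(1)] assms(4) by (simp only:)
next
  case False
  have answer: "answer S (x, y) \<longleftrightarrow> (x \<in> S \<longleftrightarrow> y \<notin> S)" for S
    unfolding answer_def fst_conv snd_conv by presburger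
  have yes: "{S \<in> V. answer S (x, y)} = {S \<in> V. x \<in> S \<longleftrightarrow> y \<notin> S}"
    unfolding answer ..
  have no: "{S \<in> V. \<not> answer S (x, y)} = {S \<in> V. x \<in> S \<longleftrightarrow> y \<in> S}"
    unfolding answer by (rule Collect_cong) argo
  have "permitted n (x, y)" using assms(2,3) False by (simp add: permitted_def)
  then show ?thesis
    by (rule win.ask[OF assms(1)]) (simp_all only: yes no assms(4,5))
qed

section \<open>From winning positions to strategies\<close>

lemma transcript_Cons:
  "transcript \<sigma> S (Suc t) = answer S (\<sigma> []) # transcript (\<lambda>h. \<sigma> (answer S (\<sigma> []) # h)) S t"
proof (induction t)
  case (Suc t)
  let ?\<sigma>' = "\<lambda>h. \<sigma> (answer S (\<sigma> []) # h)"
  have "transcript \<sigma> S (Suc (Suc t)) =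
    transcript \<sigma> S (Suc t) @ [answer S (\<sigma> (transcript \<sigma> S (Suc t)))]"
    by (rule transcript.simps)
  also have "\<dots> = answer S (\<sigma> []) # transcript ?\<sigma>' S (Suc t)"
    unfolding Suc.IH by (simp only: append_Cons transcript.simps)
  finally show ?case .
qed simp

text \<open>The strategy follows the tree: the first answer selects the strategy of the
  corresponding subtree. At a leaf everything is known, so a fixed question is repeated for
  ever.\<close>

lemma win_imp_strategy:
  "win t V \<Longrightarrow> \<exists>\<sigma>. valid_strategy n \<sigma> \<and> (\<forall>S\<in>V. \<forall>i. on_time (t + i) (possible \<sigma> V S i))"
proof (induction rule: win.induct)
  case (finish V t)
  have "spy_known n (V - {{}})"
    using finish(3)
  proof
    assume "V \<subseteq> {{}}"
    then have "V - {{}} = {}" by blast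
    then show ?thesis using spy_known_empty by (simp only:)
  qed (rule spy_known_subset, auto)
  then have "on_time j V" for j
    using finish unfolding on_time_def by blast
  then have "on_time j (possible \<sigma> V S i)" for j \<sigma> S i
    by (rule on_time_antimono) (auto simp: possible_def)
  moreover have "valid_strategy n (\<lambda>_. (1, 2))"
    using two_people by (auto simp: valid_strategy_def permitted_def people_def)
  ultimately show ?case by blast
next
  case (ask t V x y)
  obtain \<sigma>1 where \<sigma>1: "valid_strategy n \<sigma>1"
    "\<And>S i. S \<in> V \<Longrightarrow> answer S (x, y) \<Longrightarrow>
      on_time (Suc t + i) (possible \<sigma>1 {S \<in> V. answer S (x, y)} S i)"
    using ask.IH(1) by blast
  obtain \<sigma>2 where \<sigma>2: "valid_strategy n \<sigma>2"
    "\<And>S i. S \<in> V \<Longrightarrow> \<not> answer S (x, y) \<Longrightarrow>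
      on_time (Suc t + i) (possible \<sigma>2 {S \<in> V. \<not> answer S (x, y)} S i)"
    using ask.IH(2) by blast
  define \<sigma> where
    "\<sigma> = (\<lambda>h. case h of [] \<Rightarrow> (x, y) | b # h' \<Rightarrow> if b then \<sigma>1 h' else \<sigma>2 h')"
  have valid: "valid_strategy n \<sigma>"
    using ask.hyps(2) \<sigma>1(1) \<sigma>2(1) by (auto simp: valid_strategy_def \<sigma>_def split: list.split)
  have "on_time (t + i) (possible \<sigma> V S i)" if S: "S \<in> V" for S i
  proof (cases i)
    case 0
    then show ?thesis using ask.hyps(1) by (simp add: possible_def)
  next
    case (Suc j)
    have tr: "transcript \<sigma> S' (Suc j) =
      answer S' (x, y) # transcript (if answer S' (x, y) then \<sigma>1 else \<sigma>2) S' j" for S'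
      unfolding transcript_Cons by (simp add: \<sigma>_def)
    show ?thesis
    proof (cases "answer S (x, y)")
      case True
      then have "possible \<sigma> V S i = possible \<sigma>1 {S \<in> V. answer S (x, y)} S j"
        unfolding possible_def Suc tr by auto
      then show ?thesis using \<sigma>1(2)[OF S True, of j] Suc by simp
    next
      case False
      then have "possible \<sigma> V S i = possible \<sigma>2 {S \<in> V. \<not> answer S (x, y)} S j"
        unfolding possible_def Suc tr by auto
      then show ?thesis using \<sigma>2(2)[OF S False, of j] Suc by simp
    qed
  qed
  then show ?case using valid by blast
qed

section \<open>Blocks of one type and endgames led by a known knight\<close>

definition uniform :: "nat set set \<Rightarrow> nat set \<Rightarrow> bool" where
  "uniform V A \<longleftrightarrow> (\<forall>S\<in>V. A \<subseteq> S \<or> A \<inter> S = {})"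

lemma uniformD: "uniform V A \<Longrightarrow> S \<in> V \<Longrightarrow> a \<in> A \<Longrightarrow> a \<in> S \<Longrightarrow> A \<subseteq> S"
  by (auto simp: uniform_def)

lemma uniform_subset: "uniform V A \<Longrightarrow> V' \<subseteq> V \<Longrightarrow> uniform V' A"
  by (auto simp: uniform_def)

lemma uniform_singleton [simp]: "uniform V {x}"
  by (auto simp: uniform_def)

lemma uniform_subblock: "uniform V A \<Longrightarrow> B \<subseteq> A \<Longrightarrow> uniform V B"
  by (fastforce simp: uniform_def)

lemma uniform_Un:
  assumes "uniform V A" "uniform V B" "a \<in> A" "b \<in> B"
  shows "uniform {S \<in> V. a \<in> S \<longleftrightarrow> b \<in> S} (A \<union> B)"
  using assms by (fastforce simp: uniform_def)

text \<open>The knight \<open>p\<close> is asked about \<open>u\<close>: the answer tells which of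
  \<open>u\<close> and \<open>v\<close> is the spy. Person 1 is either cleared already or of the
  same type as one of them, hence settled too.\<close>

lemma win_knight_and_accusation:
  assumes p: "p \<in> people n" "\<And>S. S \<in> V \<Longrightarrow> p \<notin> S"
    and uv: "u \<in> people n" "v \<in> people n" "\<And>S. S \<in> V \<Longrightarrow> u \<in> S \<longleftrightarrow> v \<notin> S"
    and one: "(\<forall>S\<in>V. 1 \<notin> S) \<or> (\<forall>S\<in>V. 1 \<in> S \<longleftrightarrow> u \<in> S) \<or> (\<forall>S\<in>V. 1 \<in> S \<longleftrightarrow> v \<in> S)"
    and t: "on_time t V"
  shows "win t V"
proof (rule win_ask[of t V p u])
  have kn: "knight_known n V" using p by (auto simp: knight_known_def)
  have fin: "win (Suc t) V'" if V': "V' \<subseteq> V" and u: "(\<forall>S\<in>V'. u \<in> S) \<or> (\<forall>S\<in>V'. u \<notin> S)" for V'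
  proof (rule win.finish)
    show "knight_known n V'" by (rule knight_known_subset[OF kn V'])
    show "spy_known n V' \<or> V' \<subseteq> {{}}"
      using u
    proof
      assume "\<forall>S\<in>V'. u \<in> S"
      then show ?thesis using uv(1) by (auto simp: spy_known_def)
    next
      assume "\<forall>S\<in>V'. u \<notin> S"
      then have "\<forall>S\<in>V'. v \<in> S" using uv(3) V' by blast
      then show ?thesis using uv(2) by (auto simp: spy_known_def)
    qed
    show "identity_known 1 V'"
      unfolding identity_known_def using one u uv(3) V' by (meson subsetD)
  qed
  show "win (Suc t) {S \<in> V. p \<in> S \<longleftrightarrow> u \<in> S}"
    by (rule fin) (use p(2) in auto)
  show "win (Suc t) {S \<in> V. p \<in> S \<longleftrightarrow> u \<notin> S}"
    by (rule fin) (use p(2) in auto)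
qed (rule t p(1) uv(1))+

text \<open>Person 1, known to be a knight, is asked about one representative per block until a spy
  appears. If a spy is known to be present, the last test can be saved; hence
  \<open>td + 1\<close>.\<close>

lemma test_blocks:
  assumes "finite F" "\<And>A. A \<in> F \<Longrightarrow> A \<noteq> {} \<and> A \<subseteq> people n \<and> uniform V A"
    and "\<And>S. S \<in> V \<Longrightarrow> S \<subseteq> \<Union>F \<and> 1 \<notin> S"
    and "t + card F \<le> bd" "t + card F \<le> td + 1"
  shows "win t V"
  using assms
proof (induction F arbitrary: t V rule: finite_induct)
  case empty
  then show ?case
    by (intro win.finish) (auto simp: knight_known_def identity_known_def intro!: bexI[OF _ one_in_people])
next
  case (insert A F)
  have A: "A \<noteq> {}" "A \<subseteq> people n" "uniform V A" using insert.prems(1)[of A] by auto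
  obtain a where a: "a \<in> A" using A(1) by blast
  have one: "1 \<notin> S" if "S \<in> V" for S using insert.prems(2)[OF that] by blast
  have kn: "knight_known n V"
    unfolding knight_known_def using one one_in_people by (metis One_nat_def)
  have id: "identity_known 1 V" unfolding identity_known_def using one by blast
  show ?case
  proof (rule win_ask[of t V 1 a])
    \<comment> \<open>Once \<open>td\<close> is reached only the block \<open>A\<close> is untested,
      so a spy that is present must lie in \<open>A\<close>.\<close>
    have "spy_known n (V - {{}})" if "td \<le> t"
    proof -
      have "card (insert A F) = card F + 1" using insert.hyps by simp
      then have "card F = 0" using insert.prems(4) that by linarith
      then have "F = {}" using insert.hyps(1) by simp
      then have "a \<in> S" if "S \<in> V - {{}}" for S
        using insert.prems(2)[of S] A(3) a that by (auto simp: uniform_def)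
      then show ?thesis using a A(2) unfolding spy_known_def by blast
    qed
    then show "on_time t V"
      unfolding on_time_def using kn id insert.prems(3) insert.hyps by simp
    show "win (Suc t) {S \<in> V. 1 \<in> S \<longleftrightarrow> a \<in> S}"
    proof (rule insert.IH)
      fix S assume "S \<in> {S \<in> V. 1 \<in> S \<longleftrightarrow> a \<in> S}"
      then have S: "S \<in> V" "a \<notin> S" using one by auto
      then have "A \<inter> S = {}" using A(3) a by (auto simp: uniform_def)
      then show "S \<subseteq> \<Union>F \<and> 1 \<notin> S" using insert.prems(2)[OF S(1)] by blast
    next
      fix C assume "C \<in> F"
      then show "C \<noteq> {} \<and> C \<subseteq> people n \<and> uniform {S \<in> V. 1 \<in> S \<longleftrightarrow> a \<in> S} C"
        using insert.prems(1)[of C] by (auto intro: uniform_subset)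
    qed (use insert.prems(3,4) insert.hyps in simp_all)
    show "win (Suc t) {S \<in> V. 1 \<in> S \<longleftrightarrow> a \<notin> S}" (is "win _ ?V")
    proof (rule win.finish)
      have "a \<in> S" if "S \<in> ?V" for S using that one[of S] by simp
      then have "spy_known n ?V" unfolding spy_known_def using a A(2) by blast
      then show "spy_known n ?V \<or> ?V \<subseteq> {{}}" ..
    qed (rule knight_known_subset[OF kn] identity_known_subset[OF id], simp)+
  qed (use a A(2) in auto)
qed

text \<open>Agreement with \<open>a\<close> enlarges the uniform block. A disagreement is an
  accusation, which Person 1, a known knight, resolves with one further question; the strict bounds
  leave room for it.\<close>

lemma compare_with_pivot:
  assumes "finite X" "X \<subseteq> people n" "a \<in> people n" "a \<in> N" "uniform V N"
    and "\<And>S. S \<in> V \<Longrightarrow> 1 \<notin> S" "t + card X < bd" "t + card X < td"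
    and "\<And>V'. V' \<subseteq> V \<Longrightarrow> uniform V' (N \<union> X) \<Longrightarrow> win (t + card X) V'"
  shows "win t V"
  using assms
proof (induction X arbitrary: t N V rule: finite_induct)
  case empty
  then show ?case by simp
next
  case (insert x X)
  note a = insert.prems(2,3) and unif = insert.prems(4) and one = insert.prems(5)
    and time = insert.prems(6,7) and goal = insert.prems(8)
  have kn: "knight_known n V"
    unfolding knight_known_def using one one_in_people by (metis One_nat_def)
  have id: "identity_known 1 V" unfolding identity_known_def using one by blast
  have early: "on_time i V" if "i \<le> Suc t" for i
    unfolding on_time_def using kn id time insert.hyps that by simp
  have x: "x \<in> people n" using insert.prems(1) by blast
  show ?case
  proof (rule win_ask[of t V a x])
    show "win (Suc t) {S \<in> V. a \<in> S \<longleftrightarrow> x \<in> S}" (is "win _ ?V")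
    proof (rule insert.IH[of "N \<union> {x}"])
      show "uniform ?V (N \<union> {x})" by (rule uniform_Un[OF unif _ a(2)]) auto
      fix V' assume "V' \<subseteq> ?V" "uniform V' ((N \<union> {x}) \<union> X)"
      then have "win (t + card (insert x X)) V'" by (intro goal) auto
      then show "win (Suc t + card X) V'" using insert.hyps by simp
    qed (use insert.prems(1) a one time insert.hyps in simp_all)
    show "win (Suc t) {S \<in> V. a \<in> S \<longleftrightarrow> x \<notin> S}" (is "win _ ?V")
    proof (rule win_knight_and_accusation[of 1 _ a x])
      show "on_time (Suc t) ?V" by (rule on_time_antimono[OF early]) auto
      show "(\<forall>S\<in>?V. 1 \<notin> S) \<or> (\<forall>S\<in>?V. 1 \<in> S \<longleftrightarrow> a \<in> S) \<or> (\<forall>S\<in>?V. 1 \<in> S \<longleftrightarrow> x \<in> S)"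
        by (rule disjI1) (use one in simp)
    qed (use a x one in simp_all)
  qed (use a x early in simp_all)
qed

text \<open>A group of \<open>s + 1\<close> people of the same type cannot be all spies, so
  \<open>s\<close> comparisons clear it, one fewer than testing its members singly. The last
  \<open>r\<close> people are tested one by one, and the bound with \<open>+ 1\<close> reserves the
  question that follows a disagreement.\<close>

lemma test_groups:
  assumes "finite R" "R \<subseteq> people n" "\<And>S. S \<in> V \<Longrightarrow> S \<subseteq> R \<and> card S \<le> s \<and> 1 \<notin> S"
    and "card R = g * (s + 1) + r" "1 \<le> r"
    and "t + g * s + r \<le> bd" "t + g * s + r \<le> td + 1" "t + g * s + 1 \<le> td"
  shows "win t V"
  using assms
proof (induction g arbitrary: R V t)
  case 0
  show ?case
  proof (rule test_blocks[of "(\<lambda>x. {x}) ` R"])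
    show "t + card ((\<lambda>x. {x}) ` R) \<le> bd" "t + card ((\<lambda>x. {x}) ` R) \<le> td + 1"
      using 0 power2_family_singletons(2)[of R] by simp_all
  qed (use 0 in auto)
next
  case (Suc g)
  obtain A where A: "A \<subseteq> R" "card A = s + 1" "finite A"
    using obtain_subset_with_card_n[of "s + 1" R] Suc.prems(4) by auto
  then obtain a where a: "a \<in> A" by fastforce
  have card: "card (A - {a}) = s" using A a by simp
  show ?case
  proof (rule compare_with_pivot[of "A - {a}" a "{a}"])
    fix V' assume V': "V' \<subseteq> V" and "uniform V' ({a} \<union> (A - {a}))"
    then have unif: "uniform V' A" using a by (simp add: insert_absorb)
    show "win (t + card (A - {a})) V'"
      unfolding card
    proof (rule Suc.IH[of "R - A"])
      fix S assume S: "S \<in> V'"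
      then have S': "S \<subseteq> R" "card S \<le> s" "1 \<notin> S" using Suc.prems(3) V' by auto
      have "\<not> A \<subseteq> S"
        using card_mono[of S A] S'(1,2) A(2) Suc.prems(1) finite_subset[of S R] by auto
      then have "A \<inter> S = {}" using unif S by (auto simp: uniform_def)
      then show "S \<subseteq> R - A \<and> card S \<le> s \<and> 1 \<notin> S" using S' by blast
    next
      show "card (R - A) = g * (s + 1) + r"
        using A Suc.prems(1,4) by (simp add: card_Diff_subset)
    qed (use Suc.prems in auto)
  qed (use Suc.prems A a card in auto)
qed

end

subsection \<open>The hunt for a knight\<close>

text \<open>\<open>L\<close> bounds the time at which a knight is found after an accusation; one further question
  then identifies both a spy and Person 1.\<close>

locale spy_hunt = knight_spy_game +
  fixes s L :: nat
  assumes people_le: "2 * s + 1 \<le> n"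
    and L_le: "L \<le> kd" and L_less: "L < td" and td_le: "td \<le> bd"
begin

lemma on_time_early: "t < L \<Longrightarrow> on_time t V"
  using L_le L_less td_le by (simp add: on_time_def)

lemma on_time_knight: "knight_known n V \<Longrightarrow> t \<le> L \<Longrightarrow> on_time t V"
  using L_le L_less td_le by (simp add: on_time_def)

text \<open>Joining two equal blocks lowers the number of blocks by one, which pays for the
  question. Discarding two different ones lowers it by two, while the digit sum of the total drops
  by at most one. When all sizes are distinct, the largest block outnumbers the \<open>e\<close>
  possible spies, so it consists of knights, and the budget gives \<open>t \<le> L\<close>.\<close>

lemma hunt:
  assumes "power2_family F" "\<Union>F \<subseteq> people n"
    and "\<And>A. A \<in> F \<Longrightarrow> uniform V A"
    and "\<And>S. S \<in> V \<Longrightarrow> card (S \<inter> \<Union>F) \<le> e" "2 * e < card (\<Union>F)"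
    and "u \<in> people n" "v \<in> people n" "\<And>S. S \<in> V \<Longrightarrow> u \<in> S \<longleftrightarrow> v \<notin> S"
    and "(\<exists>M\<in>F. 1 \<in> M \<and> (\<forall>A\<in>F. card A \<le> card M))
      \<or> (\<forall>S\<in>V. 1 \<in> S \<longleftrightarrow> u \<in> S) \<or> (\<forall>S\<in>V. 1 \<in> S \<longleftrightarrow> v \<in> S)"
    and "t + card F \<le> L + binary_ones (card (\<Union>F))"
  shows "win t V"
  using assms
proof (induction "card F" arbitrary: F V e u v t rule: less_induct)
  case less
  note F = less.prems(1) and sub = less.prems(2) and unif = less.prems(3)
    and spies = less.prems(4) and maj = less.prems(5) and uv = less.prems(6-8)
    and one = less.prems(9) and time = less.prems(10)
  have fin: "finite F" "\<And>A. A \<in> F \<Longrightarrow> finite A" using F by (auto simp: power2_family_def)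
  show ?case
  proof (cases "inj_on card F")
    case True
    have "F \<noteq> {}" using maj by auto
    then obtain M0 where "M0 \<in> F" and max: "Max (card ` F) = card M0"
      using obtains_MAX[OF fin(1)] by metis
    moreover have "card A \<le> card M0" if "A \<in> F" for A
      unfolding max[symmetric] using fin(1) that by simp
    ultimately obtain M where M: "M \<in> F" "\<And>A. A \<in> F \<Longrightarrow> card A \<le> card M"
      and one': "1 \<in> M \<or> (\<forall>S\<in>V. 1 \<in> S \<longleftrightarrow> u \<in> S) \<or> (\<forall>S\<in>V. 1 \<in> S \<longleftrightarrow> v \<in> S)"
      using one by blast
    have "card (\<Union>F) < 2 * card M" by (rule card_distinct_power2_family_less[OF F True M])
    then have e: "e < card M" using maj by linarith
    have knights: "M \<inter> S = {}" if S: "S \<in> V" for S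
    proof -
      have "\<not> M \<subseteq> S"
      proof
        assume "M \<subseteq> S"
        then have "card M \<le> card (S \<inter> \<Union>F)"
          using M power2_family_finite_Union[OF F] by (intro card_mono) auto
        then show False using spies[OF S] e by simp
      qed
      then show ?thesis using unif[OF M(1)] S by (auto simp: uniform_def)
    qed
    obtain p where p: "p \<in> M" using power2_family_nonempty[OF F M(1)] by blast
    show ?thesis
    proof (rule win_knight_and_accusation[of p V u v])
      have "t \<le> L" using time binary_ones_power2_family_le[OF F] by linarith
      moreover have "knight_known n V"
        unfolding knight_known_def using p M(1) sub knights by blast
      ultimately show "on_time t V" by (intro on_time_knight)
      show "(\<forall>S\<in>V. 1 \<notin> S) \<or> (\<forall>S\<in>V. 1 \<in> S \<longleftrightarrow> u \<in> S) \<or> (\<forall>S\<in>V. 1 \<in> S \<longleftrightarrow> v \<in> S)"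
        using one' knights by blast
    qed (use p knights M sub uv in blast)+
  next
    case False
    then obtain A0 B0 where AB0: "A0 \<in> F" "B0 \<in> F" "A0 \<noteq> B0" "card A0 = card B0"
      by (auto simp: inj_on_def)
    \<comment> \<open>\<open>big M\<close> marks the largest block if it contains Person 1. The pair
      to be compared is chosen so that \<open>M\<close> is its first member or strictly larger than
      both; otherwise a join could overtake \<open>M\<close>.\<close>
    define big where "big M \<longleftrightarrow> M \<in> F \<and> 1 \<in> M \<and> (\<forall>A\<in>F. card A \<le> card M)" for M
    have "\<exists>A B. A \<in> F \<and> B \<in> F \<and> A \<noteq> B \<and> card A = card B \<and>
      (\<forall>M. big M \<longrightarrow> M = A \<or> card A < card M)"
    proof (cases "\<exists>M. big M \<and> card M = card A0")
      case True
      then obtain M where M: "big M" "card M = card A0" by blast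
      have uniq: "M' = M" if "big M'" for M'
        using that M(1) F unfolding big_def power2_family_def pairwise_def disjnt_def by blast
      show ?thesis
      proof (cases "M = A0")
        case True
        then show ?thesis using AB0 uniq by blast
      next
        case False
        then show ?thesis using AB0 M uniq unfolding big_def by metis
      qed
    next
      case False
      then have "card A0 < card M" if "big M" for M
      proof -
        have "card A0 \<noteq> card M" using False that by auto
        moreover have "card A0 \<le> card M" using that AB0(1) by (simp add: big_def)
        ultimately show ?thesis by simp
      qed
      then show ?thesis using AB0 by blast
    qed
    then obtain A B where AB: "A \<in> F" "B \<in> F" "A \<noteq> B" "card A = card B"
      and big: "\<And>M. big M \<Longrightarrow> M = A \<or> card A < card M" by blast
    obtain j where j: "card A = 2 ^ j" using F AB by (auto simp: power2_family_def)
    define G where "G = F - {A, B}"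
    note rm = power2_family_remove2[OF F AB(1-3), folded G_def]
    have cAB: "card (A \<union> B) = 2 ^ Suc j" using rm(4) AB(1,2,4) fin(2) j by (simp add: card_Un_disjoint)
    define H where "H = insert (A \<union> B) G"
    note ins = power2_family_insert[OF rm(1) _ cAB rm(5), folded H_def]
    have finAB: "finite (A \<union> B)" using fin AB by blast
    have UH: "\<Union>H = \<Union>F" unfolding H_def G_def using AB by blast
    have UG: "\<Union>G \<subseteq> \<Union>F" unfolding G_def by blast
    have cG: "card (\<Union>F) = card (\<Union>G) + 2 ^ Suc j" using rm(3) AB(4) j by simp
    obtain a b where ab: "a \<in> A" "b \<in> B" using power2_family_nonempty[OF F] AB by blast
    have abn: "a \<in> people n" "b \<in> people n" using ab AB sub by auto
    have cH: "card F = card H + 1" "card F = card G + 2" using rm(2) ins(3)[OF finAB] by auto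
    have tL: "t < L"
      using time binary_ones_power2_family_le[OF ins(1)[OF finAB]] cH UH by simp
    \<comment> \<open>A strictly larger power of two is at least twice as large, so \<open>M\<close>
      is not overtaken by the joined block.\<close>
    have sizes: "2 * card A \<le> card M" if "big M" "M \<noteq> A" for M
    proof -
      have "M \<in> F" using that(1) by (simp add: big_def)
      then obtain m where m: "card M = 2 ^ m" using F by (auto simp: power2_family_def)
      have "j < m" using big[OF that(1)] that(2) m j by simp
      then have "(2::nat) ^ Suc j \<le> 2 ^ m" by (intro power_increasing) auto
      then show ?thesis using m j by simp
    qed
    have bigB: "M \<noteq> B" if "big M" for M using big[OF that] AB by auto
    show ?thesis
    proof (rule win_ask[of t V a b])
      let ?V = "{S \<in> V. a \<in> S \<longleftrightarrow> b \<in> S}"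
      show "win (Suc t) ?V"
      proof (rule less.hyps[of H ?V e u v])
        show "uniform ?V C" if "C \<in> H" for C
        proof (cases "C = A \<union> B")
          case True
          then show ?thesis using uniform_Un[OF unif[OF AB(1)] unif[OF AB(2)] ab] by simp
        next
          case False
          then have "C \<in> F" using that by (auto simp: H_def G_def)
          then show ?thesis by (rule uniform_subset[OF unif]) auto
        qed
        show "(\<exists>M\<in>H. 1 \<in> M \<and> (\<forall>A\<in>H. card A \<le> card M))
          \<or> (\<forall>S\<in>?V. 1 \<in> S \<longleftrightarrow> u \<in> S) \<or> (\<forall>S\<in>?V. 1 \<in> S \<longleftrightarrow> v \<in> S)"
          using one
        proof (elim disjE)
          assume "\<exists>M\<in>F. 1 \<in> M \<and> (\<forall>A\<in>F. card A \<le> card M)"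
          then obtain M where M: "big M" by (auto simp: big_def)
          show ?thesis
          proof (cases "M = A")
            case True
            have "1 \<in> A \<union> B" "A \<union> B \<in> H" using M True by (auto simp: big_def H_def)
            moreover have "card C \<le> card (A \<union> B)" if "C \<in> H" for C
            proof (cases "C = A \<union> B")
              case False
              then have "card C \<le> card A" using that M True by (auto simp: big_def H_def G_def)
              then show ?thesis using cAB j by simp
            qed simp
            ultimately show ?thesis by blast
          next
            case False
            have "M \<in> H" "1 \<in> M" using M False bigB[OF M] by (auto simp: big_def H_def G_def)
            moreover have "card C \<le> card M" if "C \<in> H" for C
              using that M sizes[OF M False] cAB j by (auto simp: big_def H_def G_def)
            ultimately show ?thesis by blast
          qed
        qed blast+
        show "Suc t + card H \<le> L + binary_ones (card (\<Union>H))" using time cH UH by simp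
      qed (use ins(1)[OF finAB] UH sub spies maj uv cH in auto)
      let ?W = "{S \<in> V. a \<in> S \<longleftrightarrow> b \<notin> S}"
      show "win (Suc t) ?W"
      proof (cases "?W = {}")
        case True
        then show ?thesis using win_empty by (simp only:)
      next
        case False
        \<comment> \<open>One of the two blocks consists of spies: discarding
          \<open>2 * 2 ^ j\<close> people removes at least \<open>2 ^ j\<close> spies, which
          preserves the majority of knights.\<close>
        have less_spies: "card (S \<inter> \<Union>G) + 2 ^ j \<le> e" if S: "S \<in> ?W" for S
        proof -
          have "\<exists>C\<in>{A, B}. C \<subseteq> S"
            using S unif[OF AB(1)] unif[OF AB(2)] ab by (auto simp: uniform_def)
          then obtain C where C: "C \<in> {A, B}" "C \<subseteq> S" by blast
          have "card (S \<inter> \<Union>G) + 2 ^ j = card (S \<inter> \<Union>G) + card C" using C j AB by auto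
          also have "\<dots> = card ((S \<inter> \<Union>G) \<union> C)"
            using C rm(5) finAB power2_family_finite_Union[OF rm(1)]
            by (intro card_Un_disjoint[symmetric]) auto
          also have "\<dots> \<le> card (S \<inter> \<Union>F)"
            using C AB UG power2_family_finite_Union[OF F] by (intro card_mono) auto
          also have "\<dots> \<le> e" using spies S by simp
          finally show ?thesis .
        qed
        then have ej: "2 ^ j \<le> e" using False by fastforce
        \<comment> \<open>If the block of Person 1 is being discarded, the new accusation between
          \<open>a\<close> and \<open>b\<close> takes over and is linked to Person 1 through that
          block; otherwise the old accusation is kept.\<close>
        define accused where "accused u' v' \<longleftrightarrow>
          u' \<in> people n \<and> v' \<in> people n \<and> (\<forall>S\<in>?W. u' \<in> S \<longleftrightarrow> v' \<notin> S) \<and>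
          ((\<exists>M\<in>G. 1 \<in> M \<and> (\<forall>A\<in>G. card A \<le> card M))
            \<or> (\<forall>S\<in>?W. 1 \<in> S \<longleftrightarrow> u' \<in> S) \<or> (\<forall>S\<in>?W. 1 \<in> S \<longleftrightarrow> v' \<in> S))" for u' v'
        have old: "\<forall>S\<in>?W. u \<in> S \<longleftrightarrow> v \<notin> S" using uv(3) by simp
        have new: "\<forall>S\<in>?W. a \<in> S \<longleftrightarrow> b \<notin> S" by simp
        have "accused u v \<or> accused a b"
        proof (cases "\<exists>M. big M")
          case True
          then obtain M where M: "big M" by blast
          show ?thesis
          proof (cases "M = A")
            case True
            then have "1 \<in> A" using M by (simp add: big_def)
            then have "\<forall>S\<in>?W. 1 \<in> S \<longleftrightarrow> a \<in> S"
              using unif[OF AB(1)] ab by (auto simp: uniform_def)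
            then have "accused a b" unfolding accused_def
              by (intro conjI abn new) (rule disjI2, rule disjI1)
            then show ?thesis ..
          next
            case False
            then have "M \<in> G" "1 \<in> M" "\<forall>A\<in>G. card A \<le> card M"
              using M bigB[OF M] by (auto simp: big_def G_def)
            then have "\<exists>M\<in>G. 1 \<in> M \<and> (\<forall>A\<in>G. card A \<le> card M)" by blast
            then have "accused u v" unfolding accused_def
              by (intro conjI uv(1,2) old) (rule disjI1)
            then show ?thesis ..
          qed
        next
          case False
          then have "(\<forall>S\<in>V. 1 \<in> S \<longleftrightarrow> u \<in> S) \<or> (\<forall>S\<in>V. 1 \<in> S \<longleftrightarrow> v \<in> S)"
            using one unfolding big_def by blast
          then have "(\<forall>S\<in>?W. 1 \<in> S \<longleftrightarrow> u \<in> S) \<or> (\<forall>S\<in>?W. 1 \<in> S \<longleftrightarrow> v \<in> S)"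
            by (elim disjE) simp_all
          then have "accused u v" unfolding accused_def
            by (intro conjI uv(1,2) old) (rule disjI2)
          then show ?thesis ..
        qed
        then obtain u' v' where "accused u' v'" by blast
        then have uv': "u' \<in> people n" "v' \<in> people n"
          "\<forall>S\<in>?W. u' \<in> S \<longleftrightarrow> v' \<notin> S"
          "(\<exists>M\<in>G. 1 \<in> M \<and> (\<forall>A\<in>G. card A \<le> card M))
            \<or> (\<forall>S\<in>?W. 1 \<in> S \<longleftrightarrow> u' \<in> S) \<or> (\<forall>S\<in>?W. 1 \<in> S \<longleftrightarrow> v' \<in> S)"
          unfolding accused_def by - (erule conjE | assumption)+
        show ?thesis
        proof (rule less.hyps[of G ?W "e - 2 ^ j" u' v'])
          show "power2_family G" "u' \<in> people n" "v' \<in> people n" by (rule rm(1) uv'(1,2))+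
          show "(\<exists>M\<in>G. 1 \<in> M \<and> (\<forall>A\<in>G. card A \<le> card M))
            \<or> (\<forall>S\<in>?W. 1 \<in> S \<longleftrightarrow> u' \<in> S) \<or> (\<forall>S\<in>?W. 1 \<in> S \<longleftrightarrow> v' \<in> S)" by (rule uv'(4))
          show "uniform ?W C" if "C \<in> G" for C
            by (rule uniform_subset[OF unif]) (use that in \<open>auto simp: G_def\<close>)
          show "card (S \<inter> \<Union>G) \<le> e - 2 ^ j" if "S \<in> ?W" for S
            using less_spies[OF that] by simp
          show "2 * (e - 2 ^ j) < card (\<Union>G)" using maj ej cG by simp
          have "binary_ones (card (\<Union>F)) \<le> binary_ones (card (\<Union>G)) + 1"
            using binary_ones_add_le[of "card (\<Union>G)" "2 ^ Suc j"] cG by (simp del: power_Suc)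
          then show "Suc t + card G \<le> L + binary_ones (card (\<Union>G))" using time cH by simp
          show "u' \<in> S \<longleftrightarrow> v' \<notin> S" if "S \<in> ?W" for S using uv'(3) that by blast
          show "\<Union>G \<subseteq> people n" using UG sub by blast
          show "card G < card F" using cH by simp
        qed
      qed
    qed (rule abn on_time_early[OF tL])+
  qed
qed

section \<open>Joining blocks before the first accusation\<close>

definition worlds :: "nat set set" where
  "worlds = {S. S \<subseteq> people n \<and> card S \<le> s}"

definition one_leads :: "nat set set \<Rightarrow> nat \<Rightarrow> bool" where
  "one_leads F m \<longleftrightarrow> (\<exists>M\<in>F. 1 \<in> M \<and> m \<le> card M \<and> (\<forall>A\<in>F. card A \<le> card M))"

text \<open>Only the first \<open>2 * s + 1\<close> people take part: knights are already in the
  majority among them.\<close>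

definition blocks :: "nat set set \<Rightarrow> nat set set \<Rightarrow> bool" where
  "blocks F V \<longleftrightarrow> power2_family F \<and> \<Union>F \<subseteq> {1..2 * s + 1} \<and> (\<forall>A\<in>F. uniform V A)"

lemma one_leads_mono: "one_leads F m \<Longrightarrow> m' \<le> m \<Longrightarrow> one_leads F m'"
  unfolding one_leads_def by (meson order.trans)

lemma one_leads_insert:
  "1 \<in> N \<and> F = {} \<or> one_leads F m \<Longrightarrow> card N = m \<Longrightarrow> one_leads (insert N F) m"
  by (auto simp: one_leads_def)

lemma core_subset_people: "{1..2 * s + 1} \<subseteq> people n"
  using people_le by (auto simp: people_def)

lemma finite_worlds: "S \<in> worlds \<Longrightarrow> finite S"
  by (auto simp: worlds_def people_def intro: finite_subset)

lemma blocks_insert: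
  assumes "blocks F V" "V' \<subseteq> V" "uniform V' N" "N \<subseteq> {1..2 * s + 1}" "N \<inter> \<Union>F = {}" "card N = 2 ^ j"
  shows "blocks (insert N F) V'" "card (insert N F) = card F + 1"
    "card (\<Union>(insert N F)) = card N + card (\<Union>F)"
proof -
  have "finite N" using assms(4) finite_subset by blast
  note ins = power2_family_insert[OF _ this assms(6,5)]
  show "blocks (insert N F) V'"
    using ins(1) assms(1-4) by (auto simp: blocks_def intro: uniform_subset)
  show "card (insert N F) = card F + 1" "card (\<Union>(insert N F)) = card N + card (\<Union>F)"
    using ins(3,4) assms(1) by (simp_all add: blocks_def)
qed

text \<open>After the accusation between \<open>X\<close> and \<open>Y\<close>, \<open>Y\<close> and as many members of \<open>X\<close> contribute
  equally many knights and spies. The links between the remaining members of \<open>X\<close> are forgotten,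
  except inside blocks whose sizes are powers of two.\<close>

lemma accusation:
  assumes V: "V \<subseteq> worlds" and F: "blocks F V"
    and X: "X \<subseteq> {1..2 * s + 1}" "X \<inter> \<Union>F = {}" "uniform V X"
    and Y: "Y \<subseteq> {1..2 * s + 1}" "Y \<inter> \<Union>F = {}" "uniform V Y"
    and XY: "X \<inter> Y = {}" "card Y \<le> card X"
    and ab: "a \<in> X" "b \<in> Y" "\<And>S. S \<in> V \<Longrightarrow> a \<in> S \<longleftrightarrow> b \<notin> S"
    and one: "1 \<in> X \<union> Y \<or> one_leads F (card X - card Y)"
    and time: "t + card F + 1 = card (\<Union>F) + card X + card Y"
    and budget: "2 * s + binary_ones (card X - card Y) \<le> L + 1 + binary_ones (s - card Y)"
  shows "win t V"
proof -
  let ?U = "{1..2 * s + 1}"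
  have F': "power2_family F" "\<Union>F \<subseteq> ?U" "\<And>A. A \<in> F \<Longrightarrow> uniform V A"
    using F by (auto simp: blocks_def)
  have fin: "finite X" "finite Y" "finite (\<Union>F)"
    using X(1) Y(1) F'(2) finite_subset by blast+
  obtain X' where X': "X' \<subseteq> X" "card X' = card X - card Y" "finite X'"
    using obtain_subset_with_card_n[of "card X - card Y" X] by auto
  obtain G where G: "power2_family G" "\<Union>G = X'" "card G = binary_ones (card X - card Y)"
    using split_power2_family[OF X'(3)] X'(2) by auto
  \<comment> \<open>The people not yet involved enter the hunt as blocks of size one.\<close>
  define R where "R = ?U - (\<Union>F \<union> X \<union> Y)"
  have cR: "card R + card (\<Union>F) + card X + card Y = 2 * s + 1"
  proof -
    have "card (\<Union>F \<union> X \<union> Y) = card (\<Union>F) + card X + card Y"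
      using fin X(2) Y(2) XY(1) by (subst card_Un_disjoint, simp, simp, blast)+ (rule refl)
    moreover have "\<Union>F \<union> X \<union> Y \<subseteq> ?U" using F'(2) X(1) Y(1) by blast
    ultimately show ?thesis
      using card_mono[of ?U "\<Union>F \<union> X \<union> Y"] card_Diff_subset[of "\<Union>F \<union> X \<union> Y" ?U] fin
      by (simp add: R_def)
  qed
  have "finite R" by (simp add: R_def)
  note Q = power2_family_singletons[OF this]
  define H where "H = (F \<union> G) \<union> (\<lambda>x. {x}) ` R"
  have FG: "\<Union>F \<inter> \<Union>G = {}" using G(2) X'(1) X(2) by blast
  note FG = power2_family_Un[OF F'(1) G(1) FG]
  have "\<Union>(F \<union> G) \<inter> \<Union>((\<lambda>x. {x}) ` R) = {}" using G(2) X'(1) by (auto simp: R_def)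
  note H = power2_family_Un[OF FG(1) Q(1) this, folded H_def]
  have UH: "\<Union>H = \<Union>F \<union> X' \<union> R" using G(2) by (auto simp: H_def)
  have cH: "card H = card F + binary_ones (card X - card Y) + card R"
    using H(2) FG(2) Q(2) G(3) by simp
  have cY: "card Y \<le> s" using cR XY(2) by linarith
  have "card (\<Union>H) = card (\<Union>F) + (card X - card Y) + card R"
    using H(3) FG(3) G(2) X'(2) by simp
  then have cUH: "card (\<Union>H) = 2 * (s - card Y) + 1" using cR XY(2) cY by linarith
  have UHU: "\<Union>H \<subseteq> ?U" using UH F'(2) X(1) X'(1) by (auto simp: R_def)
  have sub: "\<Union>H \<subseteq> people n" using UHU core_subset_people by blast
  show ?thesis
  proof (rule hunt[of H V "s - card Y" a b])
    show "uniform V C" if C: "C \<in> H" for C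
    proof -
      consider "C \<in> F" | "C \<in> G" | x where "C = {x}" using C by (auto simp: H_def)
      then show ?thesis
      proof cases
        case 2
        then have "C \<subseteq> X" using G(2) X'(1) by blast
        then show ?thesis by (rule uniform_subblock[OF X(3)])
      qed (use F'(3) in auto)
    qed
    show "card (S \<inter> \<Union>H) \<le> s - card Y" if S: "S \<in> V" for S
    proof -
      have "S \<in> worlds" using S V by blast
      then have S': "finite S" "card S \<le> s" by (rule finite_worlds, simp add: worlds_def)
      have "X \<subseteq> S \<or> Y \<subseteq> S"
      proof (cases "a \<in> S")
        case True
        then show ?thesis using X(3) S ab(1) by (auto simp: uniform_def)
      next
        case False
        then have "b \<in> S" using ab(3)[OF S] by simp
        then show ?thesis using Y(3) S ab(2) by (auto simp: uniform_def)
      qed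
      \<comment> \<open>\<open>D\<close> consists of \<open>card Y\<close> spies kept out of the
        hunt: the dropped members of \<open>X\<close> if \<open>X\<close> consists of spies, and
        \<open>Y\<close> otherwise.\<close>
      then obtain D where D: "D \<subseteq> S" "D \<inter> \<Union>H = {}" "card D = card Y"
      proof
        assume "X \<subseteq> S"
        moreover have "card (X - X') = card Y" using X' XY(2) fin(1) by (simp add: card_Diff_subset)
        moreover have "(X - X') \<inter> \<Union>H = {}" using UH X(2) by (auto simp: R_def)
        ultimately show thesis using that[of "X - X'"] by blast
      next
        assume "Y \<subseteq> S"
        moreover have "Y \<inter> \<Union>H = {}" using UH X'(1) XY(1) Y(2) by (auto simp: R_def)
        ultimately show thesis using that[of Y] by blast
      qed
      have "card (S \<inter> \<Union>H) + card D = card (S \<inter> \<Union>H \<union> D)"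
        using D S'(1) finite_subset by (intro card_Un_disjoint[symmetric]) blast+
      also have "\<dots> \<le> card S" using D S'(1) by (intro card_mono) auto
      finally show ?thesis using D(3) S'(2) by linarith
    qed
    show "2 * (s - card Y) < card (\<Union>H)" using cUH by simp
    show "a \<in> people n" "b \<in> people n" using ab X(1) Y(1) core_subset_people by blast+
    show "a \<in> S \<longleftrightarrow> b \<notin> S" if "S \<in> V" for S by (rule ab(3)[OF that])
    show "(\<exists>M\<in>H. 1 \<in> M \<and> (\<forall>A\<in>H. card A \<le> card M))
      \<or> (\<forall>S\<in>V. 1 \<in> S \<longleftrightarrow> a \<in> S) \<or> (\<forall>S\<in>V. 1 \<in> S \<longleftrightarrow> b \<in> S)"
    proof (cases "1 \<in> X \<union> Y")
      case True
      then consider "1 \<in> X" | "1 \<in> Y" by blast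
      then show ?thesis
      proof cases
        case 1
        then have "\<forall>S\<in>V. 1 \<in> S \<longleftrightarrow> a \<in> S" using X(3) ab(1) unfolding uniform_def by blast
        then show ?thesis by (intro disjI2 disjI1)
      next
        case 2
        then have "\<forall>S\<in>V. 1 \<in> S \<longleftrightarrow> b \<in> S" using Y(3) ab(2) unfolding uniform_def by blast
        then show ?thesis by (intro disjI2)
      qed
    next
      case False
      then have "one_leads F (card X - card Y)" using one by blast
      then obtain M where M: "M \<in> F" "1 \<in> M" "card X - card Y \<le> card M" "\<forall>A\<in>F. card A \<le> card M"
        unfolding one_leads_def by blast
      have "finite M" "M \<noteq> {}" using F'(1) M(1,2) by (auto simp: power2_family_def)
      then have M1: "1 \<le> card M" by (simp add: Suc_le_eq card_gt_0_iff)
      have "card C \<le> card M" if "C \<in> H" for C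
      proof -
        consider "C \<in> F" | "C \<in> G" | x where "C = {x}" using \<open>C \<in> H\<close> by (auto simp: H_def)
        then show ?thesis
        proof cases
          case 2
          then have "C \<subseteq> X'" using G(2) by blast
          then have "card C \<le> card X'" using X'(3) by (intro card_mono)
          then show ?thesis using X'(2) M(3) by simp
        qed (use M(4) M1 in auto)
      qed
      moreover have "M \<in> H" using M(1) by (simp add: H_def)
      ultimately have "\<exists>M\<in>H. 1 \<in> M \<and> (\<forall>A\<in>H. card A \<le> card M)" using M(2) by blast
      then show ?thesis by (rule disjI1)
    qed
    \<comment> \<open>By \<open>time\<close> the left side is \<open>2 * s\<close> plus the number
      of pieces of \<open>X'\<close>. The total on the right is the odd number
      \<open>2 * (s - card Y) + 1\<close>, whose last digit accounts for the 1 in the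
      budget.\<close>
    show "t + card H \<le> L + binary_ones (card (\<Union>H))"
      using budget time cH cR cUH by simp
  qed (rule H(1) sub)+
qed

text \<open>The time equation says that all questions so far were joins: a block of \<open>m\<close>
  people has cost \<open>m - 1\<close> questions. A disagreement is handed to
  \<open>accusation\<close>.\<close>

lemma merge:
  assumes V: "V \<subseteq> worlds" and F: "blocks F V"
    and X: "X \<subseteq> {1..2 * s + 1}" "X \<inter> \<Union>F = {}" "uniform V X"
    and Y: "Y \<subseteq> {1..2 * s + 1}" "Y \<inter> \<Union>F = {}" "uniform V Y" "Y \<noteq> {}"
    and XY: "X \<inter> Y = {}" "card Y \<le> card X"
    and one: "1 \<in> X \<union> Y \<or> one_leads F (card X - card Y)"
    and time: "t + card F + 2 = card (\<Union>F) + card X + card Y" "t < L"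
    and budget: "2 * s + binary_ones (card X - card Y) \<le> L + 1 + binary_ones (s - card Y)"
    and goal: "\<And>V'. V' \<subseteq> V \<Longrightarrow> uniform V' (X \<union> Y) \<Longrightarrow> win (Suc t) V'"
  shows "win t V"
proof -
  obtain b where b: "b \<in> Y" using Y(4) by blast
  have "finite Y" using Y(1) finite_subset by blast
  then have "0 < card X" using XY(2) Y(4) card_gt_0_iff[of Y] by linarith
  then obtain a where a: "a \<in> X" by fastforce
  have "a \<in> people n" "b \<in> people n" using a b X(1) Y(1) core_subset_people by blast+
  then show ?thesis
  proof (rule win_ask[OF on_time_early[OF time(2)]])
    show "win (Suc t) {S \<in> V. a \<in> S \<longleftrightarrow> b \<in> S}"
      by (rule goal[OF _ uniform_Un[OF X(3) Y(3) a b]]) simp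
    let ?V = "{S \<in> V. a \<in> S \<longleftrightarrow> b \<notin> S}"
    have sub: "?V \<subseteq> V" by simp
    show "win (Suc t) ?V"
    proof (rule accusation[OF _ _ X(1,2) uniform_subset[OF X(3) sub] Y(1,2)
          uniform_subset[OF Y(3) sub] XY a b])
      show "?V \<subseteq> worlds" using V by blast
      show "blocks F ?V" using F uniform_subset[OF _ sub] unfolding blocks_def by blast
      show "Suc t + card F + 1 = card (\<Union>F) + card X + card Y" using time(1) by simp
    qed (simp, rule one, rule budget)
  qed
qed

text \<open>Both halves are built recursively and then compared. While the second is under
  construction the first belongs to the family \<open>F\<close>, so that an accusation at any moment
  finds all finished blocks there. Person 1 is in the new block or in one at least as large.\<close>

lemma build_power2:
  assumes "V \<subseteq> worlds" "blocks F V" "N \<subseteq> {1..2 * s + 1}" "N \<inter> \<Union>F = {}" "card N = 2 ^ j"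
    and "1 \<in> N \<and> F = {} \<or> one_leads F (2 ^ j)"
    and "t + card F = card (\<Union>F)" "t + 2 ^ j \<le> L + 1"
    and "\<And>i. i < j \<Longrightarrow> 2 * s \<le> L + 1 + binary_ones (s - 2 ^ i)"
    and "\<And>V'. V' \<subseteq> V \<Longrightarrow> blocks (insert N F) V' \<Longrightarrow> one_leads (insert N F) (2 ^ j) \<Longrightarrow>
      t + 2 ^ j - 1 + card (insert N F) = card (\<Union>(insert N F)) \<Longrightarrow> win (t + 2 ^ j - 1) V'"
  shows "win t V"
  using assms
proof (induction j arbitrary: F N t V)
  case 0
  then obtain x where x: "N = {x}" by (auto simp: card_1_singleton_iff)
  have "uniform V N" by (simp add: x)
  note ins = blocks_insert[OF 0(2) subset_refl this 0(3-5)]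
  have "one_leads (insert N F) (2 ^ 0)"
    by (rule one_leads_insert[OF 0(6,5)])
  moreover have "t + 2 ^ 0 - 1 + card (insert N F) = card (\<Union>(insert N F))"
    using 0(5,7) ins(2,3) by simp
  ultimately have "win (t + 2 ^ 0 - 1) V" using ins(1) by (intro 0(10) subset_refl)
  then show ?case by simp
next
  case (Suc j)
  note V = Suc.prems(1) and F = Suc.prems(2) and N = Suc.prems(3-5) and one = Suc.prems(6)
    and time = Suc.prems(7,8) and budget = Suc.prems(9) and goal = Suc.prems(10)
  have finN: "finite N" using N(1) finite_subset by blast
  have pos: "(1::nat) \<le> 2 ^ j" by simp
  obtain N1 where N1: "N1 \<subseteq> N" "card N1 = 2 ^ j" "1 \<in> N \<Longrightarrow> 1 \<in> N1"
    using obtain_subset_with_card_and_element[of N "2 ^ j" 1] N(3) finN pos by auto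
  define N2 where "N2 = N - N1"
  have fin: "finite N1" "finite N2" using finN N1(1) finite_subset by (auto simp: N2_def)
  have N2: "card N2 = 2 ^ j" using N1 N(3) fin(1) by (simp add: N2_def card_Diff_subset)
  have dis: "N1 \<inter> N2 = {}" "N1 \<union> N2 = N" using N1(1) by (auto simp: N2_def)
  have sub: "N1 \<subseteq> {1..2 * s + 1}" "N2 \<subseteq> {1..2 * s + 1}" using N(1) dis(2) by blast+
  have disF: "N1 \<inter> \<Union>F = {}" "N2 \<inter> \<Union>F = {}" using N(2) dis(2) by blast+
  have one1: "1 \<in> N1 \<and> F = {} \<or> one_leads F (2 ^ j)"
    using one N1(3) one_leads_mono[of F "2 ^ Suc j" "2 ^ j"] by auto
  show ?case
  proof (rule Suc.IH[OF V F sub(1) disF(1) N1(2) one1 time(1)])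
    fix V1 assume V1: "V1 \<subseteq> V" "blocks (insert N1 F) V1" "one_leads (insert N1 F) (2 ^ j)"
      "t + 2 ^ j - 1 + card (insert N1 F) = card (\<Union>(insert N1 F))"
    show "win (t + 2 ^ j - 1) V1"
    proof (rule Suc.IH[of V1 "insert N1 F" N2 "t + 2 ^ j - 1"])
      fix V2 assume V2: "V2 \<subseteq> V1" "blocks (insert N2 (insert N1 F)) V2"
      have BF: "blocks F V2" using V2(2) unfolding blocks_def
        by (auto intro: power2_family_subset)
      have "win (t + 2 ^ Suc j - 2) V2"
      proof (rule merge[OF _ BF sub(1) disF(1) _ sub(2) disF(2) _ _ dis(1)])
        show "V2 \<subseteq> worlds" using V V1(1) V2(1) by blast
        show "uniform V2 N1" "uniform V2 N2" using V2(2) by (simp_all add: blocks_def)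
        show "N2 \<noteq> {}" using N2 by auto
        show "card N2 \<le> card N1" using N1(2) N2 by simp
        show "1 \<in> N1 \<union> N2 \<or> one_leads F (card N1 - card N2)"
          using one1 N1(2) one_leads_mono[of F "2 ^ j" "card N1 - card N2"] by auto
        show "t + 2 ^ Suc j - 2 + card F + 2 = card (\<Union>F) + card N1 + card N2"
          using time(1) N1(2) N2 pos unfolding power_Suc by linarith
        show "t + 2 ^ Suc j - 2 < L" using time(2) pos unfolding power_Suc by linarith
        show "2 * s + binary_ones (card N1 - card N2) \<le> L + 1 + binary_ones (s - card N2)"
          using budget[of j] N1(2) N2 by simp
        fix V' assume V': "V' \<subseteq> V2" "uniform V' (N1 \<union> N2)"
        then have uN: "uniform V' N" using dis(2) by simp
        have sV: "V' \<subseteq> V" using V'(1) V2(1) V1(1) by blast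
        note ins = blocks_insert[OF F sV uN N]
        have "one_leads (insert N F) (2 ^ Suc j)"
          by (rule one_leads_insert[OF one N(3)])
        moreover have "t + 2 ^ Suc j - 1 + card (insert N F) = card (\<Union>(insert N F))"
          using ins(2,3) N(3) time(1) pos unfolding power_Suc by linarith
        ultimately have "win (t + 2 ^ Suc j - 1) V'"
          using ins(1) by (intro goal[OF sV])
        moreover have "Suc (t + 2 ^ Suc j - 2) = t + 2 ^ Suc j - 1"
          using pos unfolding power_Suc by linarith
        ultimately show "win (Suc (t + 2 ^ Suc j - 2)) V'" by (simp only:)
      qed
      moreover have "t + 2 ^ Suc j - 2 = t + 2 ^ j - 1 + 2 ^ j - 1"
        using pos unfolding power_Suc by linarith
      ultimately show "win (t + 2 ^ j - 1 + 2 ^ j - 1) V2" by (simp only:)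
    next
      show "V1 \<subseteq> worlds" using V V1(1) by blast
      show "N2 \<inter> \<Union>(insert N1 F) = {}" using dis(1) disF(2) by blast
      show "t + 2 ^ j - 1 + 2 ^ j \<le> L + 1"
        using time(2) pos unfolding power_Suc by linarith
    qed (use V1 sub N2 budget in \<open>auto simp del: Union_insert\<close>)
  next
    show "t + 2 ^ j \<le> L + 1" using time(2) by simp
  qed (use budget in auto)
qed

text \<open>If bit \<open>b\<close> of \<open>s\<close> is set, a block of size \<open>2 ^ b\<close>
  is built and set aside, the lower bits and the additional person are assembled recursively, and
  only then are the two compared. Thus large blocks are built first but joined last, and
  \<open>binary_ones_budget\<close> covers that comparison. At the bottom only the additional person
  is left.\<close>

lemma build_remainder:
  assumes "V \<subseteq> worlds" "blocks F V" "N \<subseteq> {1..2 * s + 1}" "N \<inter> \<Union>F = {}"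
    and "card N = s mod 2 ^ b + 1" "1 \<in> N \<and> F = {} \<or> one_leads F (2 ^ b)"
    and "t + card F = card (\<Union>F)" "t + s mod 2 ^ b \<le> L" "2 * s \<le> L + binary_ones s"
    and "\<And>V'. V' \<subseteq> V \<Longrightarrow> uniform V' N \<Longrightarrow> win (t + s mod 2 ^ b) V'"
  shows "win t V"
  using assms
proof (induction b arbitrary: F N t V)
  case 0
  then obtain x where "N = {x}" by (auto simp: card_1_singleton_iff)
  then show ?case using 0(10)[of V] by simp
next
  case (Suc b)
  note V = Suc.prems(1) and F = Suc.prems(2) and N = Suc.prems(3-5) and one = Suc.prems(6)
    and time = Suc.prems(7,8) and L = Suc.prems(9) and goal = Suc.prems(10)
  define r where "r = s mod 2 ^ b"
  have one': "1 \<in> N \<and> F = {} \<or> one_leads F (2 ^ b)"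
    using one one_leads_mono[of F "2 ^ Suc b" "2 ^ b"] by auto
  show ?case
  proof (cases "odd (s div 2 ^ b)")
    case False
    then have "s mod 2 ^ Suc b = s mod 2 ^ b"
      by (simp add: mod_mult2_eq power_Suc2 del: power_Suc)
    then show ?thesis
      using Suc.IH[OF V F N(1,2) _ one' time(1) _ L] N(3) time(2) goal by simp
  next
    case True
    have mod: "s mod 2 ^ Suc b = 2 ^ b + r"
      using True by (simp add: r_def mod_mult2_eq power_Suc2 odd_iff_mod_2_eq_one del: power_Suc)
    have rb: "r + 1 \<le> 2 ^ b" by (simp add: r_def Suc_le_eq)
    have bs: "2 ^ b \<le> s" using True by (metis div_less even_zero not_le)
    have cN: "card N = 2 ^ b + (r + 1)" using N(3) mod by simp
    have finN: "finite N" using N(1) finite_subset by blast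
    have pos: "(1::nat) \<le> 2 ^ b" by simp
    obtain N1 where N1: "N1 \<subseteq> N" "card N1 = 2 ^ b" "1 \<in> N \<Longrightarrow> 1 \<in> N1"
      using obtain_subset_with_card_and_element[of N "2 ^ b" 1] cN finN pos by auto
    define N2 where "N2 = N - N1"
    have fin: "finite N1" "finite N2" using finN N1(1) finite_subset by (auto simp: N2_def)
    have N2: "card N2 = r + 1" using N1 cN fin(1) by (simp add: N2_def card_Diff_subset)
    have dis: "N1 \<inter> N2 = {}" "N1 \<union> N2 = N" using N1(1) by (auto simp: N2_def)
    have sub: "N1 \<subseteq> {1..2 * s + 1}" "N2 \<subseteq> {1..2 * s + 1}" using N(1) dis(2) by blast+
    have disF: "N1 \<inter> \<Union>F = {}" "N2 \<inter> \<Union>F = {}" using N(2) dis(2) by blast+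
    have one1: "1 \<in> N1 \<and> F = {} \<or> one_leads F (2 ^ b)" using one' N1(3) by blast
    show ?thesis
    proof (rule build_power2[OF V F sub(1) disF(1) N1(2) one1 time(1)])
      show "t + 2 ^ b \<le> L + 1" using time(2) mod by simp
      show "2 * s \<le> L + 1 + binary_ones (s - 2 ^ i)" if "i < b" for i
      proof -
        have "(2::nat) ^ i \<le> 2 ^ b" using that by (intro power_increasing) auto
        then show ?thesis using binary_ones_budget_power2[of i s] L bs by linarith
      qed
      fix V1 assume V1: "V1 \<subseteq> V" "blocks (insert N1 F) V1" "one_leads (insert N1 F) (2 ^ b)"
        "t + 2 ^ b - 1 + card (insert N1 F) = card (\<Union>(insert N1 F))"
      show "win (t + 2 ^ b - 1) V1"
      proof (rule Suc.IH[of V1 "insert N1 F" N2 "t + 2 ^ b - 1"])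
        fix V2 assume V2: "V2 \<subseteq> V1" "uniform V2 N2"
        have BF: "blocks (insert N1 F) V2" using V1(2) V2(1) unfolding blocks_def
          by (blast intro: uniform_subset)
        then have BF': "blocks F V2" unfolding blocks_def
          by (auto intro: power2_family_subset)
        show "win (t + 2 ^ b - 1 + s mod 2 ^ b) V2"
          unfolding r_def[symmetric]
        proof (rule merge[OF _ BF' sub(1) disF(1) _ sub(2) disF(2) V2(2) _ dis(1)])
          show "V2 \<subseteq> worlds" using V V1(1) V2(1) by blast
          show "uniform V2 N1" using BF by (simp add: blocks_def)
          show "N2 \<noteq> {}" using N2 by auto
          show "card N2 \<le> card N1" using N1(2) N2 rb by simp
          show "1 \<in> N1 \<union> N2 \<or> one_leads F (card N1 - card N2)"
            using one1 N1(2) one_leads_mono[of F "2 ^ b" "card N1 - card N2"] by auto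
          show "t + 2 ^ b - 1 + r + card F + 2 = card (\<Union>F) + card N1 + card N2"
            using time(1) N1(2) N2 pos by linarith
          show "t + 2 ^ b - 1 + r < L" using time(2) pos mod by linarith
          show "2 * s + binary_ones (card N1 - card N2) \<le> L + 1 + binary_ones (s - card N2)"
            using binary_ones_budget[OF True, folded r_def] L N1(2) N2 by simp
          fix V' assume V': "V' \<subseteq> V2" "uniform V' (N1 \<union> N2)"
          then have "V' \<subseteq> V" "uniform V' N" using V2(1) V1(1) dis(2) by auto
          then have "win (t + s mod 2 ^ Suc b) V'" by (rule goal)
          moreover have "Suc (t + 2 ^ b - 1 + r) = t + s mod 2 ^ Suc b" using mod pos by linarith
          ultimately show "win (Suc (t + 2 ^ b - 1 + r)) V'" by (simp only:)
        qed
      next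
        show "V1 \<subseteq> worlds" using V V1(1) by blast
        show "N2 \<inter> \<Union>(insert N1 F) = {}" using dis(1) disF(2) by blast
        show "t + 2 ^ b - 1 + s mod 2 ^ b \<le> L" using time(2) pos mod unfolding r_def by linarith
        show "card N2 = s mod 2 ^ b + 1" using N2 by (simp add: r_def)
      qed (use V1 sub L in auto)
    qed
  qed
qed

section \<open>The two complete strategies\<close>

lemma win_one_knight:
  assumes "\<And>S. S \<in> V \<Longrightarrow> 1 \<notin> S" "\<And>S. S \<in> V \<Longrightarrow> c \<in> S" "c \<in> people n"
  shows "win t V"
proof (rule win.finish)
  show "knight_known n V"
    unfolding knight_known_def using assms(1) one_in_people by (metis One_nat_def)
  show "identity_known 1 V" unfolding identity_known_def using assms(1) by blast
  have "spy_known n V" unfolding spy_known_def using assms(2,3) by blast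
  then show "spy_known n V \<or> V \<subseteq> {{}}" ..
qed

lemma too_many_spies: "S \<in> worlds \<Longrightarrow> A \<subseteq> S \<Longrightarrow> card A \<le> s"
  using card_mono[of S A] finite_worlds[of S] by (fastforce simp: worlds_def)

text \<open>One of \<open>E\<close> and \<open>C\<close> consists of spies, which leaves at most
  \<open>2 * u\<close> further spies, and at most \<open>u\<close> if it is \<open>E\<close>. The
  four parts \<open>D1\<close>, \<open>D2\<close>, \<open>D3\<close>, \<open>{z}\<close> are
  compared until either a part too large to be spies is found, or two parts turn out to be spies,
  which clears \<open>E\<close> and so Person 1.\<close>

lemma resolve_three_to_two:
  assumes V: "V \<subseteq> worlds" and s: "s = 4 * u"
    and fin: "finite E" "finite C" "finite D1" "finite D2" "finite D3"
    and unif: "uniform V E" "uniform V C" "uniform V D1" "uniform V D2" "uniform V D3"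
    and card: "card E = 3 * u" "card C = 2 * u" "card D1 = u" "card D2 = u" "card D3 = u"
    and dis: "E \<inter> D1 = {}" "E \<inter> D2 = {}" "E \<inter> D3 = {}" "C \<inter> D1 = {}" "C \<inter> D2 = {}" "C \<inter> D3 = {}"
      "D1 \<inter> D2 = {}" "D1 \<inter> D3 = {}" "D2 \<inter> D3 = {}"
    and z: "z \<notin> E" "z \<notin> C" "z \<notin> D1" "z \<notin> D2" "z \<notin> D3"
    and mem: "1 \<in> E" "c \<in> C" "d1 \<in> D1" "d2 \<in> D2" "d3 \<in> D3"
    and people: "c \<in> people n" "d1 \<in> people n" "d2 \<in> people n" "d3 \<in> people n" "z \<in> people n"
    and accused: "\<And>S. S \<in> V \<Longrightarrow> 1 \<in> S \<longleftrightarrow> c \<notin> S"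
    and time: "t + 2 = L" "kd = L + 1" "td = L + 1" "bd = L + 2"
  shows "win t V"
proof -
  have u: "1 \<le> u" using card(3) fin(3) mem(3) by (metis card_0_eq empty_iff less_one not_le)
  have sub: "1 \<in> S \<Longrightarrow> E \<subseteq> S" "c \<in> S \<Longrightarrow> C \<subseteq> S" "d1 \<in> S \<Longrightarrow> D1 \<subseteq> S"
      "d2 \<in> S \<Longrightarrow> D2 \<subseteq> S" "d3 \<in> S \<Longrightarrow> D3 \<subseteq> S" if "S \<in> V" for S
    by (erule uniformD[OF unif(1) that mem(1)] uniformD[OF unif(2) that mem(2)]
      uniformD[OF unif(3) that mem(3)] uniformD[OF unif(4) that mem(4)]
      uniformD[OF unif(5) that mem(5)])+
  have EC: "\<exists>A\<in>{E, C}. A \<subseteq> S" if "S \<in> V" for S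
    using accused[OF that] sub(1,2)[OF that] by (cases "c \<in> S") auto
  have cards: "2 * u \<le> card A" "card A \<le> 3 * u" "finite A" "A \<inter> D1 = {}" "A \<inter> D2 = {}" "A \<inter> D3 = {}"
      "z \<notin> A" if "A \<in> {E, C}" for A
    using that card fin dis z by auto
  have limit: "card A \<le> 4 * u" if "S \<in> V" "A \<subseteq> S" for A S
    using too_many_spies[of S A] that V s by blast
  \<comment> \<open>Any two of the four parts contain more than \<open>u\<close> people, too many to
    be spies besides the \<open>3 * u\<close> members of \<open>E\<close>.\<close>
  have one: "1 \<notin> S"
    if S: "S \<in> V" and two: "d1 \<in> S \<and> d2 \<in> S \<or> z \<in> S \<and> (d1 \<in> S \<or> d2 \<in> S \<or> d3 \<in> S) \<or>
      d3 \<in> S \<and> (d1 \<in> S \<or> d2 \<in> S)" for S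
  proof
    assume "1 \<in> S"
    then have E: "E \<subseteq> S" by (rule sub(1)[OF S])
    have "\<exists>B. B \<subseteq> S \<and> E \<inter> B = {} \<and> finite B \<and> u + 1 \<le> card B"
    proof -
      consider "d1 \<in> S" "d2 \<in> S" | "z \<in> S" "d1 \<in> S" | "z \<in> S" "d2 \<in> S" | "z \<in> S" "d3 \<in> S"
        | "d3 \<in> S" "d1 \<in> S" | "d3 \<in> S" "d2 \<in> S" using two by blast
      then show ?thesis
      proof cases
        case 1
        then show ?thesis using sub(3,4)[OF S] dis card fin u
          by (intro exI[of _ "D1 \<union> D2"]) (auto simp: card_Un_disjoint)
      next
        case 2
        then show ?thesis using sub(3)[OF S] dis card fin z
          by (intro exI[of _ "insert z D1"]) auto
      next
        case 3
        then show ?thesis using sub(4)[OF S] dis card fin z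
          by (intro exI[of _ "insert z D2"]) auto
      next
        case 4
        then show ?thesis using sub(5)[OF S] dis card fin z
          by (intro exI[of _ "insert z D3"]) auto
      next
        case 5
        then show ?thesis using sub(3,5)[OF S] dis card fin u
          by (intro exI[of _ "D1 \<union> D3"]) (auto simp: card_Un_disjoint)
      next
        case 6
        then show ?thesis using sub(4,5)[OF S] dis card fin u
          by (intro exI[of _ "D2 \<union> D3"]) (auto simp: card_Un_disjoint)
      qed
    qed
    then obtain B where B: "B \<subseteq> S" "E \<inter> B = {}" "finite B" "u + 1 \<le> card B" by blast
    have "card (E \<union> B) = 3 * u + card B" using B fin(1) card(1) by (simp add: card_Un_disjoint)
    then show False using limit[OF S, of "E \<union> B"] E B by simp
  qed
  have spy: "win i V'" if "V' \<subseteq> V" "\<And>S. S \<in> V' \<Longrightarrow> 1 \<notin> S" for i V'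
    by (rule win_one_knight[OF that(2) _ people(1)]) (use that accused in blast)+
  \<comment> \<open>Up to time \<open>L\<close> any known knight suffices, because 1 and
    \<open>c\<close> form an accusation involving Person 1.\<close>
  have knight: "win i V'"
    if "V' \<subseteq> V" "p \<in> people n" "\<And>S. S \<in> V' \<Longrightarrow> p \<notin> S" "i \<le> L" for p i V'
  proof (rule win_knight_and_accusation[of p V' 1 c])
    have "knight_known n V'" unfolding knight_known_def using that(2,3) by blast
    then show "on_time i V'" using that(4) by (rule on_time_knight)
    show "(\<forall>S\<in>V'. 1 \<notin> S) \<or> (\<forall>S\<in>V'. (1 \<in> S) = (1 \<in> S)) \<or> (\<forall>S\<in>V'. (1 \<in> S) = (c \<in> S))"
      by simp
    show "(1 \<in> S) = (c \<notin> S)" if "S \<in> V'" for S using that \<open>V' \<subseteq> V\<close> by (intro accused) blast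
  qed (use that people one_in_people in auto)
  show ?thesis
  proof (rule win_ask[of t V d1 d2])
    show "on_time t V" by (rule on_time_early) (use time in simp)
    let ?V = "{S \<in> V. d1 \<in> S \<longleftrightarrow> d2 \<in> S}"
    show "win (Suc t) ?V"
    proof (rule win_ask[of _ _ d1 d3])
      show "on_time (Suc t) ?V" by (rule on_time_early) (use time in simp)
      let ?W = "{S \<in> ?V. d1 \<in> S \<longleftrightarrow> d3 \<in> S}"
      show "win (Suc (Suc t)) ?W"
      proof (rule knight[of _ d1])
        fix S assume "S \<in> ?W"
        then have S: "S \<in> V" "d1 \<in> S \<longleftrightarrow> d2 \<in> S" "d1 \<in> S \<longleftrightarrow> d3 \<in> S"
          by - (elim CollectE conjE, assumption)+
        show "d1 \<notin> S"
        proof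
          assume "d1 \<in> S"
          then have "D1 \<union> D2 \<union> D3 \<subseteq> S" using S(2,3) sub(3-5)[OF S(1)] by blast
          moreover obtain A where A: "A \<in> {E, C}" "A \<subseteq> S" using EC[OF S(1)] by blast
          ultimately have "card (A \<union> (D1 \<union> D2 \<union> D3)) \<le> 4 * u" by (intro limit[OF S(1)]) blast
          moreover have "card (D1 \<union> D2 \<union> D3) = 3 * u"
            using card fin dis by (simp add: card_Un_disjoint Int_Un_distrib2)
          moreover have "card (A \<union> (D1 \<union> D2 \<union> D3)) = card A + card (D1 \<union> D2 \<union> D3)"
            using cards[OF A(1)] fin by (intro card_Un_disjoint) auto
          ultimately show False using cards(1)[OF A(1)] u by simp
        qed
      qed (use people time in auto)
      let ?X = "{S \<in> ?V. d1 \<in> S \<longleftrightarrow> d3 \<notin> S}"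
      \<comment> \<open>Now \<open>t + 2 = L\<close>, and still nothing is due, since
        \<open>kd\<close> and \<open>td\<close> are \<open>L + 1\<close>. If \<open>d1\<close> and
        \<open>z\<close> differ, either \<open>D1\<close> and \<open>D2\<close> or \<open>D3\<close>
        and \<open>z\<close> are spies.\<close>
      show "win (Suc (Suc t)) ?X"
      proof (rule win_ask[of _ _ d1 z])
        show "on_time (Suc (Suc t)) ?X" using time unfolding on_time_def by simp
        let ?Y = "{S \<in> ?X. d1 \<in> S \<longleftrightarrow> z \<in> S}"
        \<comment> \<open>If \<open>d1\<close> were a spy, \<open>D1\<close>, \<open>D2\<close> and
          \<open>z\<close> would add \<open>2 * u + 1\<close> spies to the \<open>2 * u\<close> or
          more in \<open>E\<close> or \<open>C\<close>.\<close>
        have Y: "d1 \<notin> S \<and> d3 \<in> S" if "S \<in> ?Y" for S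
        proof -
          have S: "S \<in> V" "d1 \<in> S \<longleftrightarrow> d2 \<in> S" "d1 \<in> S \<longleftrightarrow> d3 \<notin> S" "d1 \<in> S \<longleftrightarrow> z \<in> S"
            using that by - (elim CollectE conjE, assumption)+
          have "d1 \<notin> S"
          proof
            assume "d1 \<in> S"
            then have "insert z (D1 \<union> D2) \<subseteq> S" using S(2,4) sub(3-4)[OF S(1)] by blast
            moreover obtain A where A: "A \<in> {E, C}" "A \<subseteq> S" using EC[OF S(1)] by blast
            ultimately have "card (A \<union> insert z (D1 \<union> D2)) \<le> 4 * u" by (intro limit[OF S(1)]) blast
            moreover have "card (insert z (D1 \<union> D2)) = 2 * u + 1"
              using card fin dis z by (simp add: card_Un_disjoint)
            moreover have "card (A \<union> insert z (D1 \<union> D2)) = card A + card (insert z (D1 \<union> D2))"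
              using cards[OF A(1)] fin by (intro card_Un_disjoint) auto
            ultimately show False using cards(1)[OF A(1)] by simp
          qed
          then show ?thesis using S(3) by simp
        qed
        have kn: "knight_known n ?Y" unfolding knight_known_def using Y people(2) by blast
        have sp: "spy_known n ?Y" unfolding spy_known_def using Y people(4) by blast
        \<comment> \<open>The knight \<open>d1\<close> and the spy \<open>d3\<close> are known just
          in time; the one question left settles Person 1.\<close>
        show "win (Suc (Suc (Suc t))) ?Y"
        proof (rule win_ask[of _ _ d1 1])
          have "spy_known n (?Y - {{}})" by (rule spy_known_subset[OF sp]) simp
          then show "on_time (Suc (Suc (Suc t))) ?Y" using kn time unfolding on_time_def by simp
          have fin: "win i V'" if "V' \<subseteq> ?Y" "(\<forall>S\<in>V'. 1 \<in> S) \<or> (\<forall>S\<in>V'. 1 \<notin> S)" for i V'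
          proof (rule win.finish)
            show "knight_known n V'" by (rule knight_known_subset[OF kn that(1)])
            show "identity_known 1 V'" using that(2) by (simp add: identity_known_def)
            show "spy_known n V' \<or> V' \<subseteq> {{}}" using spy_known_subset[OF sp that(1)] ..
          qed
          show "win (Suc (Suc (Suc (Suc t)))) {S \<in> ?Y. d1 \<in> S \<longleftrightarrow> 1 \<in> S}"
          proof (intro fin disjI2 ballI)
            fix S assume "S \<in> {S \<in> ?Y. d1 \<in> S \<longleftrightarrow> 1 \<in> S}"
            then have S: "S \<in> ?Y" "d1 \<in> S \<longleftrightarrow> 1 \<in> S" by - (erule CollectE, erule conjE, assumption)+
            show "1 \<notin> S" using S(2) Y[OF S(1)] by argo
          qed (rule Collect_restrict)
          show "win (Suc (Suc (Suc (Suc t)))) {S \<in> ?Y. d1 \<in> S \<longleftrightarrow> 1 \<notin> S}"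
          proof (intro fin disjI1 ballI)
            fix S assume "S \<in> {S \<in> ?Y. d1 \<in> S \<longleftrightarrow> 1 \<notin> S}"
            then have S: "S \<in> ?Y" "d1 \<in> S \<longleftrightarrow> 1 \<notin> S" by - (erule CollectE, erule conjE, assumption)+
            show "1 \<in> S" using S(2) Y[OF S(1)] by argo
          qed (rule Collect_restrict)
        qed (use people one_in_people in simp_all)
        show "win (Suc (Suc (Suc t))) {S \<in> ?X. d1 \<in> S \<longleftrightarrow> z \<notin> S}"
        proof (rule spy)
          fix S assume "S \<in> {S \<in> ?X. d1 \<in> S \<longleftrightarrow> z \<notin> S}"
          then have S: "S \<in> V" "d1 \<in> S \<longleftrightarrow> d2 \<in> S" "d1 \<in> S \<longleftrightarrow> d3 \<notin> S" "d1 \<in> S \<longleftrightarrow> z \<notin> S"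
            by - (elim CollectE conjE, assumption)+
          show "1 \<notin> S" by (rule one[OF S(1)]) (use S(2-4) in argo)
        qed auto
      qed (use people in simp_all)
    qed (use people in simp_all)
    let ?V = "{S \<in> V. d1 \<in> S \<longleftrightarrow> d2 \<notin> S}"
    \<comment> \<open>One of \<open>D1\<close> and \<open>D2\<close> consists of spies. If
      \<open>d3\<close> and \<open>z\<close> agree, they cannot be spies as well; if they differ,
      one of them is a second spy part.\<close>
    show "win (Suc t) ?V"
    proof (rule win_ask[of _ _ d3 z])
      show "on_time (Suc t) ?V" by (rule on_time_early) (use time in simp)
      show "win (Suc (Suc t)) {S \<in> ?V. d3 \<in> S \<longleftrightarrow> z \<in> S}"
      proof (rule knight[of _ d3])
        fix S assume "S \<in> {S \<in> ?V. d3 \<in> S \<longleftrightarrow> z \<in> S}"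
        then have S: "S \<in> V" "d1 \<in> S \<longleftrightarrow> d2 \<notin> S" "d3 \<in> S \<longleftrightarrow> z \<in> S"
          by - (elim CollectE conjE, assumption)+
        show "d3 \<notin> S"
        proof
          assume "d3 \<in> S"
          then have D3: "insert z D3 \<subseteq> S" using S(3) sub(5)[OF S(1)] by blast
          obtain A where A: "A \<in> {E, C}" "A \<subseteq> S" using EC[OF S(1)] by blast
          have "\<exists>D\<in>{D1, D2}. D \<subseteq> S" using S(2) sub(3,4)[OF S(1)] by (cases "d1 \<in> S") auto
          then obtain D where D: "D \<in> {D1, D2}" "D \<subseteq> S" by blast
          have "card (A \<union> (D \<union> insert z D3)) \<le> 4 * u"
            using D3 A(2) D(2) by (intro limit[OF S(1)]) blast
          moreover have "card (insert z D3) = u + 1" using card fin z by simp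
          moreover have "card (D \<union> insert z D3) = card D + card (insert z D3)"
            using D(1) fin dis z by (intro card_Un_disjoint) auto
          moreover have "card D = u" "finite D" using D(1) card fin by auto
          moreover have "card (A \<union> (D \<union> insert z D3)) = card A + card (D \<union> insert z D3)"
            using cards[OF A(1)] D(1) fin by (intro card_Un_disjoint) auto
          ultimately show False using cards(1)[OF A(1)] by simp
        qed
      qed (use people time in auto)
      show "win (Suc (Suc t)) {S \<in> ?V. d3 \<in> S \<longleftrightarrow> z \<notin> S}"
      proof (rule spy)
        fix S assume "S \<in> {S \<in> ?V. d3 \<in> S \<longleftrightarrow> z \<notin> S}"
        then have S: "S \<in> V" "d1 \<in> S \<longleftrightarrow> d2 \<notin> S" "d3 \<in> S \<longleftrightarrow> z \<notin> S"
          by - (elim CollectE conjE, assumption)+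
        show "1 \<notin> S" by (rule one[OF S(1)]) (use S(2,3) in argo)
      qed auto
    qed (use people in simp_all)
  qed (use people in simp_all)
qed

text \<open>The first \<open>s + 1\<close> people are joined with \<open>s\<close> questions and
  cannot all be spies. Person 1 is among them and tests the remaining \<open>g * (s + 1) + r\<close>
  people.\<close>

lemma win_from_one_block:
  assumes L: "2 * s \<le> L + binary_ones s"
    and n: "n = (g + 1) * (s + 1) + r" "1 \<le> r"
    and deadlines: "(g + 1) * s + r \<le> bd" "(g + 1) * s + r \<le> td + 1" "(g + 1) * s + 1 \<le> td"
  shows "win 0 worlds"
proof (rule build_remainder[of worlds "{}" "{1..s + 1}" s 0])
  \<comment> \<open>Since \<open>s < 2 ^ s\<close>, this exponent makes the remainder all of
    \<open>s\<close>.\<close>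
  have mod: "s mod 2 ^ s = s" by (simp add: less_exp)
  show "card {1..s + 1} = s mod 2 ^ s + 1" "0 + s mod 2 ^ s \<le> L"
    unfolding mod using L binary_ones_le[of s] by simp_all
  show "blocks {} worlds" by (simp add: blocks_def power2_family_def)
  fix V' assume V': "V' \<subseteq> worlds" "uniform V' {1..s + 1}"
  show "win (0 + s mod 2 ^ s) V'"
    unfolding mod
  proof (rule test_groups[where g = g and r = r])
    show "card {s + 2..n} = g * (s + 1) + r" using n by simp
    show "{s + 2..n} \<subseteq> people n" by (auto simp: people_def)
    fix S assume S: "S \<in> V'"
    then have SW: "S \<in> worlds" using V'(1) by blast
    have "\<not> {1..s + 1} \<subseteq> S" using too_many_spies[OF SW, of "{1..s + 1}"] by auto
    then have dis: "{1..s + 1} \<inter> S = {}" using V'(2) S by (auto simp: uniform_def)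
    have "S \<subseteq> {1..n}" "card S \<le> s" using SW by (auto simp: worlds_def people_def)
    moreover have "x \<in> {s + 2..n}" if "x \<in> S" for x
    proof -
      have "x \<notin> {1..s + 1}" using dis that by blast
      moreover have "x \<in> {1..n}" using \<open>S \<subseteq> {1..n}\<close> that by blast
      ultimately show ?thesis by simp
    qed
    moreover have "1 \<notin> S"
    proof
      assume "1 \<in> S"
      moreover have "1 \<in> {1..s + 1}" by simp
      ultimately show False using dis by blast
    qed
    ultimately show "S \<subseteq> {s + 2..n} \<and> card S \<le> s \<and> 1 \<notin> S" by blast
  qed (use n deadlines in \<open>simp_all add: algebra_simps\<close>)
qed (use L in auto)

text \<open>If \<open>n = 2 * s + 1\<close> and \<open>s\<close> is a power of two, then a spy known to be present is due at the
  same time as a knight, and the block of size \<open>s\<close> formed by \<open>build_remainder\<close> would be fatal: were it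
  accused by anyone, all remaining questions would be needed. It is therefore avoided by first
  joining blocks of sizes \<open>s / 2\<close> and \<open>s / 4\<close>.\<close>

lemma win_power2:
  assumes u: "u = 2 ^ c" and s: "s = 4 * u" and n: "n = 8 * u + 1"
    and time: "L + 2 = 8 * u" "kd = L + 1" "td = L + 1" "bd = L + 2"
  shows "win 0 worlds"
proof -
  \<comment> \<open>Two blocks of size \<open>s div 2\<close> and four of size
    \<open>s div 4\<close> are prepared; person \<open>8 * u + 1\<close> stays alone.
    \<open>C1\<close>, with Person 1, and \<open>D0\<close> will form the block \<open>E\<close> of
    size \<open>3 * u\<close>.\<close>
  define C1 C2 D0 D1 D2 D3 where defs: "C1 = {1..2 * u}" "C2 = {2 * u + 1..4 * u}"
    "D0 = {4 * u + 1..5 * u}" "D1 = {5 * u + 1..6 * u}" "D2 = {6 * u + 1..7 * u}"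
    "D3 = {7 * u + 1..8 * u}"
  have u1: "1 \<le> u" by (simp add: u)
  \<comment> \<open>\<open>build_power2\<close> with an explicit finishing time \<open>t'\<close>.
    The six blocks, each costing its size minus one, are complete at time
    \<open>8 * u - 6\<close>.\<close>
  have step: "win t V"
    if "V \<subseteq> worlds" "blocks F V" "N \<subseteq> {1..8 * u + 1}" "N \<inter> \<Union>F = {}" "card N = 2 ^ j" "j \<le> Suc c"
      "1 \<in> N \<and> F = {} \<or> one_leads F (2 ^ j)" "t + card F = card (\<Union>F)"
      "t' + 1 = t + 2 ^ j" "t' + 2 \<le> 8 * u"
      "\<And>V'. V' \<subseteq> V \<Longrightarrow> blocks (insert N F) V' \<Longrightarrow> one_leads (insert N F) (2 ^ j) \<Longrightarrow>
        t' + card (insert N F) = card (\<Union>(insert N F)) \<Longrightarrow> win t' V'" for V F N j t t'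
  proof (rule build_power2[OF that(1,2) _ that(4,5,7,8)])
    have t': "t + 2 ^ j - 1 = t'" using that(9) by simp
    show "N \<subseteq> {1..2 * s + 1}" using that(3) s by simp
    show "t + 2 ^ j \<le> L + 1" using that(9,10) time(1) by simp
    \<comment> \<open>Here \<open>L + 2 = 2 * s\<close>, so a single digit of
      \<open>s - 2 ^ i\<close> pays for the comparison.\<close>
    show "2 * s \<le> L + 1 + binary_ones (s - 2 ^ i)" if i: "i < j" for i
    proof -
      have "(2::nat) ^ i \<le> 2 ^ c" using i \<open>j \<le> Suc c\<close> by (intro power_increasing) auto
      then have "2 ^ i \<le> u" using u by simp
      then have "0 < s - 2 ^ i" using s u1 by linarith
      then show ?thesis using binary_ones_pos[of "s - 2 ^ i"] s time(1) by linarith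
    qed
    show "win (t + 2 ^ j - 1) V'"
      if "V' \<subseteq> V" "blocks (insert N F) V'" "one_leads (insert N F) (2 ^ j)"
        "t + 2 ^ j - 1 + card (insert N F) = card (\<Union>(insert N F))" for V'
      using that \<open>\<And>V'. V' \<subseteq> V \<Longrightarrow> blocks (insert N F) V' \<Longrightarrow> one_leads (insert N F) (2 ^ j) \<Longrightarrow>
        t' + card (insert N F) = card (\<Union>(insert N F)) \<Longrightarrow> win t' V'\<close>
      unfolding t' by blast
  qed
  have card2: "card C1 = 2 ^ Suc c" "card C2 = 2 ^ Suc c" and card1: "card D0 = 2 ^ c"
      "card D1 = 2 ^ c" "card D2 = 2 ^ c" "card D3 = 2 ^ c"
    using u by (simp_all add: defs)
  have sub: "C1 \<subseteq> {1..8 * u + 1}" "C2 \<subseteq> {1..8 * u + 1}" "D0 \<subseteq> {1..8 * u + 1}"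
      "D1 \<subseteq> {1..8 * u + 1}" "D2 \<subseteq> {1..8 * u + 1}" "D3 \<subseteq> {1..8 * u + 1}"
    by (auto simp: defs)
  have dis: "C2 \<inter> C1 = {}" "D0 \<inter> C1 = {}" "D0 \<inter> C2 = {}" "D1 \<inter> C1 = {}" "D1 \<inter> C2 = {}"
      "D1 \<inter> D0 = {}" "D2 \<inter> C1 = {}" "D2 \<inter> C2 = {}" "D2 \<inter> D0 = {}" "D2 \<inter> D1 = {}"
      "D3 \<inter> C1 = {}" "D3 \<inter> C2 = {}" "D3 \<inter> D0 = {}" "D3 \<inter> D1 = {}" "D3 \<inter> D2 = {}"
    by (auto simp: defs)
  have one: "1 \<in> C1" using u1 by (simp add: defs)
  have pow: "(2::nat) ^ Suc c = 2 * u" "(2::nat) ^ c = u" using u by simp_all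
  have lead: "one_leads F u" if "one_leads F (2 ^ Suc c)" for F
    by (rule one_leads_mono[OF that]) (simp add: u)
  define F where "F = {D3, D2, D1, D0, C2, C1}"
  have merged: "win (8 * u - 6) V"
    if V: "V \<subseteq> worlds" and F: "blocks F V" "8 * u - 6 + card F = card (\<Union>F)" for V
  proof -
    have unif: "uniform V C1" "uniform V C2" "uniform V D0" "uniform V D1" "uniform V D2" "uniform V D3"
      using F(1) by (simp_all add: blocks_def F_def)
    have fam: "power2_family F" using F(1) by (simp add: blocks_def)
    have "C1 \<noteq> D0" using dis(2) one by blast
    then have rm: "power2_family (F - {C1, D0})" "card F = card (F - {C1, D0}) + 2"
        "card (\<Union>F) = card (\<Union>(F - {C1, D0})) + card C1 + card D0"
        "C1 \<inter> D0 = {}" "(C1 \<union> D0) \<inter> \<Union>(F - {C1, D0}) = {}"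
      using power2_family_remove2[OF fam, of C1 D0] by (auto simp: F_def)
    \<comment> \<open>The two digits of \<open>s - u = 3 * u\<close> are exactly what the comparison
      of \<open>C1\<close> with \<open>D0\<close> costs.\<close>
    have three: "binary_ones (s - u) = 2"
    proof -
      have "s - u = 2 ^ c * (2 * 1 + 1)" using s u by simp
      then show ?thesis by (simp only: binary_ones_power2_mult binary_ones_double_add_1 binary_ones_1)
    qed
    define E where "E = C1 \<union> D0"
    have cE: "card E = 3 * u" using dis(2) card2 card1 pow
      by (simp add: E_def card_Un_disjoint Int_commute defs)
    show ?thesis
    proof (rule merge[OF V, of "F - {C1, D0}" C1 D0])
      show "blocks (F - {C1, D0}) V" using F(1) rm(1) by (auto simp: blocks_def)
      show "C1 \<subseteq> {1..2 * s + 1}" "D0 \<subseteq> {1..2 * s + 1}" using sub s by auto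
      show "C1 \<inter> \<Union>(F - {C1, D0}) = {}" "D0 \<inter> \<Union>(F - {C1, D0}) = {}" using rm(5) by blast+
      show "D0 \<noteq> {}" using u1 by (simp add: defs)
      show "8 * u - 6 + card (F - {C1, D0}) + 2 = card (\<Union>(F - {C1, D0})) + card C1 + card D0"
        using F(2) rm(2,3) by linarith
      show "2 * s + binary_ones (card C1 - card D0) \<le> L + 1 + binary_ones (s - card D0)"
        using card2 card1 pow three s time(1) binary_ones_power2[of c] by simp
      show "8 * u - 6 < L" using time(1) u1 by linarith
      show "1 \<in> C1 \<union> D0 \<or> one_leads (F - {C1, D0}) (card C1 - card D0)" using one by blast
      show "card D0 \<le> card C1" using card2 card1 by simp
    next
      fix V7 assume V7: "V7 \<subseteq> V" "uniform V7 (C1 \<union> D0)"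
      have unif7: "uniform V7 E" "uniform V7 C2" "uniform V7 D1" "uniform V7 D2" "uniform V7 D3"
        using V7 unif by (auto simp: E_def intro: uniform_subset)
      define c where "c = 4 * u"
      have c: "c \<in> C2" "c \<in> people n" using u1 by (auto simp: defs c_def people_def n)
      have oneE: "1 \<in> E" using one by (simp add: E_def)
      have d: "6 * u \<in> D1" "7 * u \<in> D2" "8 * u \<in> D3" using u1 by (auto simp: defs)
      show "win (Suc (8 * u - 6)) V7"
      proof (rule win_ask[of _ _ 1 c])
        show "on_time (Suc (8 * u - 6)) V7" by (rule on_time_early) (use time u1 in linarith)
        let ?V = "{S \<in> V7. 1 \<in> S \<longleftrightarrow> c \<in> S}"
        \<comment> \<open>Agreement makes \<open>E\<close> and \<open>C2\<close> a block of
          \<open>5 * u\<close> people, more than \<open>s\<close>, hence knights. At most four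
          blocks remain to be tested, which ends at \<open>bd\<close> at the latest.\<close>
        show "win (Suc (Suc (8 * u - 6))) ?V"
        proof (rule test_blocks[of "{D1, D2, D3, {8 * u + 1}}"])
          have "card {D1, D2, D3, {8 * u + 1}} \<le> 4" by (simp add: card_insert_if)
          then show "Suc (Suc (8 * u - 6)) + card {D1, D2, D3, {8 * u + 1}} \<le> bd"
            "Suc (Suc (8 * u - 6)) + card {D1, D2, D3, {8 * u + 1}} \<le> td + 1"
            using time u1 by linarith+
          fix A assume "A \<in> {D1, D2, D3, {8 * u + 1}}"
          moreover have "D1 \<subseteq> people n" "D2 \<subseteq> people n" "D3 \<subseteq> people n" "{8 * u + 1} \<subseteq> people n"
            using sub by (auto simp: people_def n)
          moreover have "D1 \<noteq> {}" "D2 \<noteq> {}" "D3 \<noteq> {}" using d by blast+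
          ultimately show "A \<noteq> {} \<and> A \<subseteq> people n \<and> uniform ?V A"
            using unif7(3-5) by (auto intro: uniform_subset)
        next
          fix S assume S: "S \<in> ?V"
          have unifEC: "uniform ?V (E \<union> C2)" by (rule uniform_Un[OF unif7(1,2) oneE c(1)])
          have SW: "S \<in> worlds" using S V V7(1) by blast
          have "card (E \<union> C2) = 5 * u"
          proof -
            have "E \<inter> C2 = {}" using dis by (auto simp: E_def)
            then have "card (E \<union> C2) = card E + card C2"
              by (intro card_Un_disjoint) (auto simp: E_def defs)
            then show ?thesis using cE card2 pow by simp
          qed
          then have "\<not> E \<union> C2 \<subseteq> S" using too_many_spies[OF SW, of "E \<union> C2"] s u1 by auto
          then have disS: "(E \<union> C2) \<inter> S = {}" using unifEC S unfolding uniform_def by blast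
          have "x \<in> \<Union>{D1, D2, D3, {8 * u + 1}}" if x: "x \<in> S" for x
          proof -
            have "x \<in> {1..8 * u + 1}"
              using SW x unfolding worlds_def people_def n[symmetric] by blast
            moreover have "x \<notin> C1" "x \<notin> D0" "x \<notin> C2" using disS x by (auto simp: E_def)
            ultimately show ?thesis by (simp add: defs) linarith
          qed
          moreover have "1 \<notin> S" using disS oneE by blast
          ultimately show "S \<subseteq> \<Union>{D1, D2, D3, {8 * u + 1}} \<and> 1 \<notin> S" by blast
        qed simp
        let ?W = "{S \<in> V7. 1 \<in> S \<longleftrightarrow> c \<notin> S}"
        have WV: "?W \<subseteq> V7" by (rule Collect_restrict)
        \<comment> \<open>The budget of \<open>accusation\<close> would be exceeded by one, as the
          surplus \<open>u\<close> and \<open>s - 2 * u\<close> both have digit sum 1. Hence the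
          separate analysis.\<close>
        show "win (Suc (Suc (8 * u - 6))) ?W"
        proof (rule resolve_three_to_two[where u = u and E = E and C = C2 and ?D1.0 = D1
              and ?D2.0 = D2 and ?D3.0 = D3 and z = "8 * u + 1" and c = c and ?d1.0 = "6 * u"
              and ?d2.0 = "7 * u" and ?d3.0 = "8 * u"])
          show "?W \<subseteq> worlds" using WV V7(1) V by blast
          show "uniform ?W E" "uniform ?W C2" "uniform ?W D1" "uniform ?W D2" "uniform ?W D3"
            by (rule uniform_subset[OF unif7(1) WV] uniform_subset[OF unif7(2) WV]
              uniform_subset[OF unif7(3) WV] uniform_subset[OF unif7(4) WV]
              uniform_subset[OF unif7(5) WV])+
          show "(1 \<in> S) = (c \<notin> S)" if "S \<in> ?W" for S using that by - (elim CollectE conjE, assumption)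
          show "card C2 = 2 * u" "card D1 = u" "card D2 = u" "card D3 = u"
            using card2 card1 pow by simp_all
          show "E \<inter> D1 = {}" "E \<inter> D2 = {}" "E \<inter> D3 = {}" using dis by (auto simp: E_def)
          show "C2 \<inter> D1 = {}" "C2 \<inter> D2 = {}" "C2 \<inter> D3 = {}" "D1 \<inter> D2 = {}" "D1 \<inter> D3 = {}"
            "D2 \<inter> D3 = {}" by (auto simp: defs)
          show "finite E" "finite C2" "finite D1" "finite D2" "finite D3"
            by (simp_all add: E_def defs)
          show "8 * u + 1 \<notin> E" "8 * u + 1 \<notin> C2" "8 * u + 1 \<notin> D1" "8 * u + 1 \<notin> D2"
            "8 * u + 1 \<notin> D3" by (simp_all add: E_def defs)
          show "6 * u \<in> people n" "7 * u \<in> people n" "8 * u \<in> people n" "8 * u + 1 \<in> people n"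
            using u1 by (simp_all add: people_def n)
          show "Suc (Suc (8 * u - 6)) + 2 = L" using time(1) u1 by linarith
        qed (rule s cE oneE c d time)+
      qed (use c one_in_people in simp_all)
    qed (rule unif rm)+
  qed
  show ?thesis
  proof (rule step[of worlds "{}" C1 "Suc c" 0 "2 * u - 1"])
    show "blocks {} worlds" by (simp add: blocks_def power2_family_def)
    fix V1 assume V1: "V1 \<subseteq> worlds" "blocks {C1} V1" "one_leads {C1} (2 ^ Suc c)"
      "2 * u - 1 + card {C1} = card (\<Union>{C1})"
    show "win (2 * u - 1) V1"
    proof (rule step[OF V1(1,2), of C2 "Suc c" _ "4 * u - 2"])
      fix V2 assume V2: "V2 \<subseteq> V1" "blocks {C2, C1} V2" "one_leads {C2, C1} (2 ^ Suc c)"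
        "4 * u - 2 + card {C2, C1} = card (\<Union>{C2, C1})"
      have W2: "V2 \<subseteq> worlds" using V1(1) V2(1) by blast
      show "win (4 * u - 2) V2"
      proof (rule step[OF W2 V2(2), of D0 c _ "5 * u - 3"])
        fix V3 assume V3: "V3 \<subseteq> V2" "blocks {D0, C2, C1} V3" "one_leads {D0, C2, C1} (2 ^ c)"
          "5 * u - 3 + card {D0, C2, C1} = card (\<Union>{D0, C2, C1})"
        have W3: "V3 \<subseteq> worlds" using W2 V3(1) by blast
        show "win (5 * u - 3) V3"
        proof (rule step[OF W3 V3(2), of D1 c _ "6 * u - 4"])
          fix V4 assume V4: "V4 \<subseteq> V3" "blocks {D1, D0, C2, C1} V4" "one_leads {D1, D0, C2, C1} (2 ^ c)"
            "6 * u - 4 + card {D1, D0, C2, C1} = card (\<Union>{D1, D0, C2, C1})"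
          have W4: "V4 \<subseteq> worlds" using W3 V4(1) by blast
          show "win (6 * u - 4) V4"
          proof (rule step[OF W4 V4(2), of D2 c _ "7 * u - 5"])
            fix V5 assume V5: "V5 \<subseteq> V4" "blocks {D2, D1, D0, C2, C1} V5"
              "one_leads {D2, D1, D0, C2, C1} (2 ^ c)"
              "7 * u - 5 + card {D2, D1, D0, C2, C1} = card (\<Union>{D2, D1, D0, C2, C1})"
            have W5: "V5 \<subseteq> worlds" using W4 V5(1) by blast
            show "win (7 * u - 5) V5"
            proof (rule step[OF W5 V5(2), of D3 c _ "8 * u - 6"])
              fix V6 assume V6: "V6 \<subseteq> V5" "blocks {D3, D2, D1, D0, C2, C1} V6"
                "8 * u - 6 + card {D3, D2, D1, D0, C2, C1} = card (\<Union>{D3, D2, D1, D0, C2, C1})"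
              have "V6 \<subseteq> worlds" using W5 V6(1) by blast
              then show "win (8 * u - 6) V6" using V6(2,3) by (intro merged) (simp_all only: F_def)
            qed (use sub(6) dis card1 V5(3,4) u1 pow in auto)
          qed (use sub(5) dis card1 V4(3,4) u1 pow in auto)
        qed (use sub(4) dis card1 V3(3,4) u1 pow in auto)
      qed (use sub(3) dis card1 V2(4) lead[OF V2(3)] u1 pow in auto)
    qed (use sub(2) dis card2 V1(3,4) u1 pow in auto)
  qed (use sub(1) card2 one u1 pow in auto)
qed

end

subsection \<open>The deadlines\<close>

text \<open>Taking remainders from 1 to \<open>n - k + 1\<close> instead of 0 to
  \<open>n - k\<close> absorbs the case of remainder 0: the quotient drops by one, and both
  deadlines follow a uniform formula.\<close>

lemma T_values:
  assumes n: "n = q * (n - k + 1) + r" and r: "1 \<le> r" "r \<le> n - k + 1" and "k < n"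
  shows "T_bar n k = n - q"
    and "T_tilde n k = (if n = 5 \<and> k = 3 then 4 else if r = 1 then n - q else n - q - 1)"
proof -
  define s where "s = n - k"
  have s: "1 \<le> s" using \<open>k < n\<close> by (simp add: s_def)
  have nq: "n = q * (s + 1) + r" "r \<le> s + 1" using n r(2) by (simp_all add: s_def)
  have "T_bar n k = n - q \<and>
    T_tilde n k = (if n = 5 \<and> k = 3 then 4 else if r = 1 then n - q else n - q - 1)"
  proof (cases "r = s + 1")
    case True
    then have "n = (q + 1) * (s + 1)" using nq(1) by simp
    then have "n div (s + 1) = q + 1 \<and> n mod (s + 1) = 0"
      by (metis add_is_0 mod_mult_self2_is_0 nonzero_mult_div_cancel_right zero_neq_one)
    then have div: "n div (s + 1) = q + 1" "n mod (s + 1) = 0" by blast+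
    have "q + 1 \<le> n" using nq(1) True by simp
    then show ?thesis
      unfolding T_bar_def T_tilde_def Let_def s_def[symmetric] div using True s by auto
  next
    case False
    then have "r < s + 1" using nq(2) by simp
    then have div: "n div (s + 1) = q" "n mod (s + 1) = r"
      using div_mult_self3[of "s + 1" q r] mod_mult_self3[of q "s + 1" r] nq(1)
        div_less[of r "s + 1"] mod_less[of r "s + 1"] by auto
    show ?thesis
      unfolding T_bar_def T_tilde_def Let_def s_def[symmetric] div using r(1) by simp
  qed
  then show "T_bar n k = n - q"
    and "T_tilde n k = (if n = 5 \<and> k = 3 then 4 else if r = 1 then n - q else n - q - 1)"
    by blast+
qed

lemma assignments_eq:
  assumes "k \<le> n"
  shows "assignments n k = {S. S \<subseteq> people n \<and> card S \<le> n - k}"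
proof -
  have "k \<le> card (people n - S) \<longleftrightarrow> card S \<le> n - k" if "S \<subseteq> people n" for S
  proof -
    have "finite S" using that finite_subset by (auto simp: people_def)
    then have "card (people n - S) = n - card S"
      using that by (simp add: card_Diff_subset people_def)
    moreover have "card S \<le> n" using card_mono[OF _ that] by (simp add: people_def)
    ultimately show ?thesis using assms by linarith
  qed
  then show ?thesis by (auto simp: assignments_def)
qed

text \<open>After an accusation a spy needs one question more than a knight, so the strategy from
  one block requires \<open>K n k < T_tilde n k\<close>. This fails only if
  \<open>n = 2 * s + 1\<close> and \<open>s\<close> is a power of two, at least 4; then
  \<open>win_power2\<close> applies.\<close>

lemma exists_winning_strategy:
  fixes n k :: nat
  assumes "n < 2 * k" and "k < n"
  shows "knight_spy_game.win n (K n k) (T_tilde n k) (T_bar n k) 0 (assignments n k)"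
proof -
  define s where "s = n - k"
  define q where "q = (n - 1) div (s + 1)"
  define r where "r = (n - 1) mod (s + 1) + 1"
  have s: "1 \<le> s" "2 * s + 1 \<le> n" using assms by (auto simp: s_def)
  have r: "1 \<le> r" "r \<le> s + 1" by (simp_all add: r_def Suc_le_eq)
  have nq: "n = q * (s + 1) + r"
    using div_mult_mod_eq[of "n - 1" "s + 1"] s unfolding q_def r_def by linarith
  have "q \<noteq> 0"
  proof
    assume "q = 0"
    then show False using nq r(2) s by simp
  qed
  then obtain g where g: "q = g + 1" by (metis Suc_eq_plus1 not0_implies_Suc)
  have nq': "n - q = q * s + r" using nq by simp
  have bar: "T_bar n k = q * s + r"
    using T_values(1)[OF nq[unfolded s_def] r(1) r(2)[unfolded s_def] assms(2)] nq' by simp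
  have tilde: "T_tilde n k =
      (if n = 5 \<and> k = 3 then 4 else if r = 1 then q * s + r else q * s + r - 1)"
    using T_values(2)[OF nq[unfolded s_def] r(1) r(2)[unfolded s_def] assms(2)] nq' by simp
  have K: "K n k = 2 * s - binary_ones s" by (simp add: K_def s_def)
  have ones: "1 \<le> binary_ones s" "binary_ones s \<le> s"
    using s(1) binary_ones_pos[of s] binary_ones_le[of s] by auto
  have worlds: "assignments n k = {S. S \<subseteq> people n \<and> card S \<le> s}"
    using assignments_eq[of k n] assms(2) by (simp add: s_def)
  have five: "q = 1 \<and> r = 2 \<and> s = 2" if "n = 5" "k = 3"
  proof -
    have "s = 2" using that by (simp add: s_def)
    then show ?thesis using that by (simp add: q_def r_def)
  qed
  have gs: "2 * s \<le> q * s" if "q \<noteq> 1"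
    using that g by (intro mult_le_mono1) simp
  have qs: "s \<le> q * s" using g by simp
  show ?thesis
  proof (cases "K n k < T_tilde n k")
    case True
    have "T_tilde n k \<le> T_bar n k" using bar tilde five r(1) by auto
    then interpret spy_hunt n "K n k" "T_tilde n k" "T_bar n k" s "K n k"
      using s True by unfold_locales simp_all
    have "win 0 worlds"
    proof (rule win_from_one_block[of g r])
      show "2 * s \<le> K n k + binary_ones s" using K ones by simp
      show "n = (g + 1) * (s + 1) + r" using nq g by simp
      show "(g + 1) * s + r \<le> T_bar n k" using bar g by simp
      show "(g + 1) * s + r \<le> T_tilde n k + 1" "(g + 1) * s + 1 \<le> T_tilde n k"
        using tilde five g r(1) by (auto split: if_splits)
    qed (rule r)
    then show ?thesis using worlds by (simp add: worlds_def)
  next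
    case False
    \<comment> \<open>With a larger quotient \<open>T_tilde n k\<close> would be at least
      \<open>2 * s\<close>, hence above \<open>K n k\<close>.\<close>
    have q1: "q = 1"
    proof (rule ccontr)
      assume "q \<noteq> 1"
      then have "q * s + 1 \<le> T_tilde n k" using tilde five r(1) by (auto split: if_splits)
      then have "2 * s \<le> T_tilde n k" using gs[OF \<open>q \<noteq> 1\<close>] by linarith
      then show False using False K ones s by linarith
    qed
    have rs: "r = s"
    proof (rule ccontr)
      assume "r \<noteq> s"
      then have "r = s + 1" using q1 nq r(2) s(2) by simp
      then have "2 * s \<le> T_tilde n k" using tilde five q1 s(1) by (auto split: if_splits)
      then show False using False K ones s by linarith
    qed
    have n: "n = 2 * s + 1" using nq q1 rs by simp
    have not5: "\<not> (n = 5 \<and> k = 3)"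
    proof
      assume "n = 5 \<and> k = 3"
      then have "s = 2" "T_tilde n k = 4" using five tilde by auto
      then show False using False K ones(1) by simp
    qed
    have "s \<noteq> 1"
    proof
      assume "s = 1"
      then show False using tilde not5 q1 rs False K ones by simp
    qed
    then have tilde': "T_tilde n k = 2 * s - 1" using tilde not5 q1 rs by simp
    have "binary_ones s = 1" using False K tilde' ones s by linarith
    then obtain a where a: "s = 2 ^ a" using binary_ones_eq_1 by blast
    \<comment> \<open>\<open>s = 2\<close> would be the pair \<open>n = 5\<close>,
      \<open>k = 3\<close>, whose exceptional value 4 lies above \<open>K 5 3 = 3\<close>.\<close>
    have "s \<noteq> 2" using not5 n s_def assms(2) by linarith
    then have "a \<noteq> 0" "a \<noteq> 1" using a \<open>s \<noteq> 1\<close> by auto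
    then obtain c where "a = Suc (Suc c)" by (metis One_nat_def not0_implies_Suc)
    then have c: "s = 4 * 2 ^ c" using a by simp
    have pos: "(1::nat) \<le> 2 ^ c" by simp
    \<comment> \<open>\<open>L\<close> is \<open>K n k - 1\<close>: the question that follows an
      accusation must fit before \<open>T_tilde n k\<close>, which here equals
      \<open>K n k\<close>.\<close>
    interpret spy_hunt n "K n k" "T_tilde n k" "T_bar n k" s "2 * s - 2"
      using s n tilde' bar K \<open>binary_ones s = 1\<close> q1 rs by unfold_locales simp_all
    have "win 0 worlds"
    proof (rule win_power2[OF refl c])
      show "n = 8 * 2 ^ c + 1" using n c by simp
      show "2 * s - 2 + 2 = 8 * 2 ^ c" using c pos by linarith
      show "K n k = 2 * s - 2 + 1" using K \<open>binary_ones s = 1\<close> s(1) by linarith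
      show "T_tilde n k = 2 * s - 2 + 1" using tilde' s(1) by linarith
      show "T_bar n k = 2 * s - 2 + 2"
      proof -
        have "T_bar n k = 2 * s" using bar q1 rs by simp
        then show ?thesis using s(1) by linarith
      qed
    qed
    then show ?thesis using worlds by (simp add: worlds_def)
  qed
qed

theorem theorem4:
  fixes n k :: nat
  assumes "n < 2 * k" and "k < n"
  shows "\<exists>\<sigma>. valid_strategy n \<sigma> \<and>
    (\<forall>S\<in>assignments n k.
       knight_identified n \<sigma> (assignments n k) S (K n k) \<and>
       identity_determined 1 \<sigma> (assignments n k) S (K n k + 1) \<and>
       (spy_identified n \<sigma> (assignments n k) S (T_bar n k) \<or>
        all_knights_proved \<sigma> (assignments n k) S (T_bar n k))) \<and>
    (\<forall>S\<in>assignments n k - {{}}.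
       spy_identified n \<sigma> (assignments n k - {{}}) S (T_tilde n k))"
proof -
  let ?W = "assignments n k"
  interpret knight_spy_game n "K n k" "T_tilde n k" "T_bar n k"
    using assms by unfold_locales simp
  obtain \<sigma> where \<sigma>: "valid_strategy n \<sigma>"
    and goal: "\<And>S t. S \<in> ?W \<Longrightarrow> on_time t (possible \<sigma> ?W S t)"
    using win_imp_strategy[OF exists_winning_strategy[OF assms]] by auto
  \<comment> \<open>Knowing that a spy is present only removes the empty set from what is possible,
    so the same strategy serves the last claim.\<close>
  have "possible \<sigma> (?W - {{}}) S t = possible \<sigma> ?W S t - {{}}" for S t
    by (auto simp: possible_def)
  then have "spy_identified n \<sigma> (?W - {{}}) S (T_tilde n k)" if "S \<in> ?W" for S
    using goal[OF that, of "T_tilde n k"]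
    by (simp add: on_time_def spy_known_def spy_identified_def)
  moreover have "knight_identified n \<sigma> ?W S (K n k)" if "S \<in> ?W" for S
    using goal[OF that, of "K n k"]
    by (simp add: on_time_def knight_known_def knight_identified_def)
  moreover have "identity_determined 1 \<sigma> ?W S (K n k + 1)" if "S \<in> ?W" for S
    using goal[OF that, of "K n k + 1"]
    by (simp add: on_time_def identity_known_def identity_determined_def)
  moreover have "spy_identified n \<sigma> ?W S (T_bar n k) \<or> all_knights_proved \<sigma> ?W S (T_bar n k)"
    if "S \<in> ?W" for S
    using goal[OF that, of "T_bar n k"]
    by (auto simp: on_time_def spy_known_def spy_identified_def all_knights_proved_def)
  ultimately show ?thesis using \<sigma> by blast
qed

end
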